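(* For every $\mu\ge0$ there exists a minimizer of $J_\mu$ among all $\Omega\in\mathcal{C}$ with $P(\Omega)=2\pi$ which is centrally symmetric (has a center of symmetry).
   Context: Let $\mathcal{C}$ be the class of bounded open convex sets $\Omega\subset\mathbb{R}^2$ whose boundary, of length $P$, is parametrized by arc length $s\mapsto(x(s),y(s))$ with $x'=\cos\theta$, $y'=\sin\theta$, $\theta\in W^{1,2}(0,P)$, $\theta'\ge0$ a.e., $\theta(P)=\theta(0)+2\pi$, $\int_0^P\cos\theta=\int_0^P\sin\theta=0$. Curvature $k=\theta'$, $E(\Omega)=\frac12\int_0^Pk^2ds$, $A$ area, $P$ perimeter, $J_\mu=E+\mu A$. *)

theory Defs
  imports "HOL-Analysis.Analysis"
begin

text \<open>Tangent angle theta(s) = theta0 + int_0^s k, with k in L^2(0,P), i.e. theta in W^{1,2}(0,P)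
  with theta' = k.\<close>
definition tangent_angle :: "real \<Rightarrow> (real \<Rightarrow> real) \<Rightarrow> real \<Rightarrow> real" where
  "tangent_angle \<theta>0 k s = \<theta>0 + (LINT t:{0..s}|lborel. k t)"

definition bcurve :: "real \<times> real \<Rightarrow> real \<Rightarrow> (real \<Rightarrow> real) \<Rightarrow> real \<Rightarrow> real \<times> real" where
  "bcurve z0 \<theta>0 k s =
     (fst z0 + (LINT t:{0..s}|lborel. cos (tangent_angle \<theta>0 k t)),
      snd z0 + (LINT t:{0..s}|lborel. sin (tangent_angle \<theta>0 k t)))"

text \<open>(P, k, theta0, z0) is an admissible parametrization of the boundary of Omega,
  so that Omega belongs to the class C with perimeter P and curvature k.\<close>
definition admissible_param ::
  "(real \<times> real) set \<Rightarrow> real \<Rightarrow> (real \<Rightarrow> real) \<Rightarrow> real \<Rightarrow> real \<times> real \<Rightarrow> bool" where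
  "admissible_param \<Omega> P k \<theta>0 z0 \<longleftrightarrow>
     bounded \<Omega> \<and> open \<Omega> \<and> convex \<Omega> \<and> P > 0 \<and>
     k \<in> borel_measurable lborel \<and>
     set_integrable lborel {0..P} k \<and>
     set_integrable lborel {0..P} (\<lambda>s. (k s)\<^sup>2) \<and>
     (AE s in lborel. s \<in> {0..P} \<longrightarrow> k s \<ge> 0) \<and>
     tangent_angle \<theta>0 k P = \<theta>0 + 2 * pi \<and>
     (LINT s:{0..P}|lborel. cos (tangent_angle \<theta>0 k s)) = 0 \<and>
     (LINT s:{0..P}|lborel. sin (tangent_angle \<theta>0 k s)) = 0 \<and>
     frontier \<Omega> = bcurve z0 \<theta>0 k ` {0..P}"

definition in_class_C :: "(real \<times> real) set \<Rightarrow> bool" where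
  "in_class_C \<Omega> \<longleftrightarrow> (\<exists>P k \<theta>0 z0. admissible_param \<Omega> P k \<theta>0 z0)"

definition elastic_energy :: "real \<Rightarrow> (real \<Rightarrow> real) \<Rightarrow> real" where
  "elastic_energy P k = (1/2) * (LINT s:{0..P}|lborel. (k s)\<^sup>2)"

definition area :: "(real \<times> real) set \<Rightarrow> real" where
  "area \<Omega> = measure lebesgue \<Omega>"

definition J :: "real \<Rightarrow> (real \<times> real) set \<Rightarrow> real \<Rightarrow> (real \<Rightarrow> real) \<Rightarrow> real" where
  "J \<mu> \<Omega> P k = elastic_energy P k + \<mu> * area \<Omega>"

definition centrally_symmetric :: "(real \<times> real) set \<Rightarrow> bool" where
  "centrally_symmetric \<Omega> \<longleftrightarrow> (\<exists>c. \<forall>p. p \<in> \<Omega> \<longleftrightarrow> 2 *\<^sub>R c - p \<in> \<Omega>)"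

end

theory Submission
  imports Defs "HOL-Complex_Analysis.Great_Picard"
begin

text \<open>
  Two points that halve the length of the curve can be chosen with opposite tangent directions: the
  turning of the arc of length \<open>\<pi>\<close> starting at \<open>s\<close>, minus \<open>\<pi>\<close>, changes sign when \<open>s\<close> is replaced
  by \<open>s + \<pi>\<close>. Cutting along the chord between them and completing each half by its point reflection in
  the midpoint of the chord yields two centrally symmetric competitors whose energies and areas average
  to those of the given set, so one of them is at least as good.

  A symmetric competitor is given by a nondecreasing tangent angle \<open>\<theta>\<close> on \<open>[0, \<pi>]\<close> with total turning
  \<open>\<pi>\<close>; the closing condition is then automatic, and its support function in the normal direction
  at angle \<open>\<phi>\<close> is half the integral of \<open>\<bar>sin (\<theta> - \<phi>)\<bar>\<close>. Hence the body depends
  continuously on \<open>\<theta>\<close> in the uniform norm, and the direct method applies to the symmetric problem.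
\<close>

subsection \<open>Centrally symmetric bodies and their halves\<close>

text \<open>It suffices to solve the symmetric problem, because every admissible set dominates some
  symmetric competitor. Cutting at equal lengths keeps the perimeter at \<open>2 * pi\<close>;
  opposite tangents at the cuts make each half turn by exactly \<open>pi\<close>, so that its
  reflected continuation starts without a corner, which would cost infinite energy. Because a body
  is described by its support function, convexity, compactness and symmetry are immediate, and the
  geometric work lies in recovering its boundary: every line through the centre meets the half
  curve, and each point of the half curve lies on a supporting line of the body. All area
  comparisons are made by inclusion. A slightly shrunken copy of a limit body fits into the bodies
  near it, and a symmetric body is covered by the hull of its half curve and the reflection of that
  hull. Both inequalities point in the direction that \<open>\<mu> \<ge> 0\<close> can use.\<close>

text \<open>The inner product with \<open>(- sin \<phi>, cos \<phi>)\<close>, the inward normal of a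
  counterclockwise curve where its tangent angle is \<open>\<phi>\<close>.\<close>

definition normal_coord :: "real \<Rightarrow> real \<times> real \<Rightarrow> real" where
  "normal_coord \<phi> p = snd p * cos \<phi> - fst p * sin \<phi>"

definition cross :: "real \<times> real \<Rightarrow> real \<times> real \<Rightarrow> real" where
  "cross p q = fst p * snd q - snd p * fst q"

text \<open>The half with tangent angle \<open>\<theta>\<close>, placed so that the midpoint of its chord is the origin.\<close>
definition half_curve :: "(real \<Rightarrow> real) \<Rightarrow> real \<Rightarrow> real \<times> real" where
  "half_curve \<theta> t =
     ((integral {0..t} (\<lambda>u. cos (\<theta> u)) - integral {t..pi} (\<lambda>u. cos (\<theta> u))) / 2,
      (integral {0..t} (\<lambda>u. sin (\<theta> u)) - integral {t..pi} (\<lambda>u. sin (\<theta> u))) / 2)"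

text \<open>The support function of a zonoid: the Minkowski integral over \<open>u\<close> of the
  segments joining plus and minus one half of the unit tangent at angle \<open>\<theta> u\<close>.
  Each segment contributes half of \<open>\<bar>sin (\<theta> u - \<phi>)\<bar>\<close> in the
  normal direction.\<close>

definition half_width :: "(real \<Rightarrow> real) \<Rightarrow> real \<Rightarrow> real" where
  "half_width \<theta> \<phi> = integral {0..pi} (\<lambda>u. \<bar>sin (\<theta> u - \<phi>)\<bar>) / 2"

definition sym_body :: "(real \<Rightarrow> real) \<Rightarrow> (real \<times> real) set" where
  "sym_body \<theta> = {p. \<forall>\<phi>. \<bar>normal_coord \<phi> p\<bar> \<le> half_width \<theta> \<phi>}"

section \<open>Convexity, compactness and symmetry from the support description\<close>

lemma normal_coord_simps:
  "normal_coord \<phi> (p + q) = normal_coord \<phi> p + normal_coord \<phi> q"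
  "normal_coord \<phi> (p - q) = normal_coord \<phi> p - normal_coord \<phi> q"
  "normal_coord \<phi> (- p) = - normal_coord \<phi> p"
  "normal_coord \<phi> (c *\<^sub>R p) = c * normal_coord \<phi> p"
  "normal_coord \<phi> 0 = 0"
  by (auto simp: normal_coord_def algebra_simps)

lemma cross_simps:
  "cross a (p + q) = cross a p + cross a q"
  "cross a (- p) = - cross a p"
  "cross (- a) p = - cross a p"
  "cross a (c *\<^sub>R p) = c * cross a p"
  by (auto simp: cross_def algebra_simps)

lemma abs_normal_coord_le_norm: "\<bar>normal_coord \<phi> p\<bar> \<le> norm p"
proof -
  have "(normal_coord \<phi> p)\<^sup>2 + (fst p * cos \<phi> + snd p * sin \<phi>)\<^sup>2
      = ((fst p)\<^sup>2 + (snd p)\<^sup>2) * ((sin \<phi>)\<^sup>2 + (cos \<phi>)\<^sup>2)"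
    by (simp only: normal_coord_def power2_eq_square) algebra
  then have "(normal_coord \<phi> p)\<^sup>2 + (fst p * cos \<phi> + snd p * sin \<phi>)\<^sup>2 = (fst p)\<^sup>2 + (snd p)\<^sup>2"
    by simp
  then have "(normal_coord \<phi> p)\<^sup>2 \<le> (fst p)\<^sup>2 + (snd p)\<^sup>2"
    using zero_le_power2[of "fst p * cos \<phi> + snd p * sin \<phi>"] by linarith
  then have "\<bar>normal_coord \<phi> p\<bar> \<le> sqrt ((fst p)\<^sup>2 + (snd p)\<^sup>2)"
    by (metis real_sqrt_abs real_sqrt_le_mono)
  then show ?thesis
    by (cases p) (simp add: norm_Pair)
qed

lemma cross_zero_imp_multiple:
  assumes "cross p q = 0" "p \<noteq> 0"
  shows "\<exists>c. q = c *\<^sub>R p"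
proof (cases "fst p = 0")
  case True
  then have "snd p \<noteq> 0" using assms(2) by (simp add: prod_eq_iff)
  then have "q = (snd q / snd p) *\<^sub>R p"
    using assms(1) True by (simp add: cross_def prod_eq_iff)
  then show ?thesis ..
next
  case False
  then have "q = (fst q / fst p) *\<^sub>R p"
    using assms(1) by (simp add: cross_def prod_eq_iff field_simps)
  then show ?thesis ..
qed

lemma convex_cross_ge: "convex {x. 0 \<le> cross a x}"
  by (auto simp: convex_def cross_simps)

text \<open>The shift of the angle function normalizes the starting angle of a minimizing sequence;
  the shift of the direction reduces a lower bound over all directions to one period.\<close>

lemma half_width_shift:
  "half_width (\<lambda>u. \<theta> u + of_int m * (2 * pi)) \<phi> = half_width \<theta> \<phi>"
  "half_width \<theta> (\<phi> - of_int m * (2 * pi)) = half_width \<theta> \<phi>"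
proof -
  have per: "sin (x + of_int m * (2 * pi)) = sin x" for x
    using sin.plus_of_int[of x m] by (simp add: mult.commute)
  have *: "sin (\<theta> u + of_int m * (2 * pi) - \<phi>) = sin (\<theta> u - \<phi>)"
       "sin (\<theta> u - (\<phi> - of_int m * (2 * pi))) = sin (\<theta> u - \<phi>)" for u
    using per[of "\<theta> u - \<phi>"] by (simp_all add: algebra_simps)
  show "half_width (\<lambda>u. \<theta> u + of_int m * (2 * pi)) \<phi> = half_width \<theta> \<phi>"
  "half_width \<theta> (\<phi> - of_int m * (2 * pi)) = half_width \<theta> \<phi>"
    unfolding half_width_def * by simp_all
qed

lemma sym_body_shift: "sym_body (\<lambda>u. \<theta> u + of_int m * (2 * pi)) = sym_body \<theta>"
  by (simp add: sym_body_def half_width_shift)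

lemma convex_sym_body: "convex (sym_body \<theta>)"
proof (rule convexI)
  fix x y and u v :: real
  assume x: "x \<in> sym_body \<theta>" and y: "y \<in> sym_body \<theta>" and u: "0 \<le> u" "0 \<le> v" "u + v = 1"
  show "u *\<^sub>R x + v *\<^sub>R y \<in> sym_body \<theta>"
    unfolding sym_body_def
  proof clarify
    fix \<phi>
    have "\<bar>normal_coord \<phi> (u *\<^sub>R x + v *\<^sub>R y)\<bar>
        \<le> u * \<bar>normal_coord \<phi> x\<bar> + v * \<bar>normal_coord \<phi> y\<bar>"
      using u by (auto simp: normal_coord_simps abs_mult intro!: order_trans[OF abs_triangle_ineq])
    also have "\<dots> \<le> u * half_width \<theta> \<phi> + v * half_width \<theta> \<phi>"
      using x y u by (intro add_mono mult_left_mono) (auto simp: sym_body_def)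
    also have "\<dots> = half_width \<theta> \<phi>"
      using u by (simp add: distrib_right[symmetric])
    finally show "\<bar>normal_coord \<phi> (u *\<^sub>R x + v *\<^sub>R y)\<bar> \<le> half_width \<theta> \<phi>" .
  qed
qed

lemma compact_sym_body: "compact (sym_body \<theta>)"
proof -
  have "closed (sym_body \<theta>)"
    unfolding sym_body_def normal_coord_def
    by (intro closed_Collect_all closed_Collect_le continuous_intros)
  moreover have "bounded (sym_body \<theta>)"
  proof (rule boundedI)
    fix p assume p: "p \<in> sym_body \<theta>"
    have "\<bar>snd p\<bar> \<le> half_width \<theta> 0" "\<bar>fst p\<bar> \<le> half_width \<theta> (pi/2)"
      using p[unfolded sym_body_def, simplified, rule_format, of 0]
            p[unfolded sym_body_def, simplified, rule_format, of "pi/2"]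
      by (auto simp: normal_coord_def)
    moreover have "norm p \<le> \<bar>fst p\<bar> + \<bar>snd p\<bar>"
      by (metis norm_Pair_le prod.collapse real_norm_def)
    ultimately show "norm p \<le> half_width \<theta> (pi/2) + half_width \<theta> 0" by linarith
  qed
  ultimately show ?thesis by (simp add: compact_eq_bounded_closed)
qed

lemma sym_body_uminus: "- p \<in> sym_body \<theta> \<longleftrightarrow> p \<in> sym_body \<theta>"
  by (simp add: sym_body_def normal_coord_simps)

lemma uminus_image_sym_body: "uminus ` sym_body \<theta> = sym_body \<theta>"
proof (intro equalityI subsetI)
  fix p assume "p \<in> sym_body \<theta>"
  then show "p \<in> uminus ` sym_body \<theta>"
    by (intro image_eqI[of _ _ "- p"]) (auto simp: sym_body_uminus)
qed (use sym_body_uminus in blast)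

lemma interior_sym_body_uminus: "- p \<in> interior (sym_body \<theta>) \<longleftrightarrow> p \<in> interior (sym_body \<theta>)"
proof -
  have "uminus ` interior (sym_body \<theta>) = interior (sym_body \<theta>)"
    using interior_negations[of "sym_body \<theta>"] by (simp add: uminus_image_sym_body)
  then show ?thesis by (metis add.inverse_inverse image_eqI)
qed

text \<open>The sine is 1-Lipschitz, and \<open>pi / 2\<close> is the length of the interval times
  the factor 1/2 in \<open>half_width\<close>. Varying both the direction and the angle function
  lets one estimate serve for continuity in \<open>\<phi>\<close> and for stability under uniform
  perturbation of \<open>\<theta>\<close>.\<close>

lemma half_width_le_add:
  assumes "continuous_on {0..pi} \<theta>" "continuous_on {0..pi} \<theta>'"
    and "\<And>u. u \<in> {0..pi} \<Longrightarrow> \<bar>(\<theta> u - \<phi>) - (\<theta>' u - \<phi>')\<bar> \<le> \<eta>"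
  shows "half_width \<theta> \<phi> \<le> half_width \<theta>' \<phi>' + pi / 2 * \<eta>"
proof -
  have sin_lip: "\<bar>sin x - sin y\<bar> \<le> \<bar>x - y\<bar>" for x y :: real
  proof -
    have "\<bar>sin x - sin y\<bar> = 2 * \<bar>sin ((x - y) / 2)\<bar> * \<bar>cos ((x + y) / 2)\<bar>"
      by (simp add: sin_diff_sin abs_mult)
    also have "\<dots> \<le> 2 * \<bar>(x - y) / 2\<bar> * 1"
      by (intro mult_mono abs_sin_x_le_abs_x) auto
    finally show ?thesis by simp
  qed
  have int: "(\<lambda>u. \<bar>sin (\<theta> u - \<phi>)\<bar>) integrable_on {0..pi}" "(\<lambda>u. \<bar>sin (\<theta>' u - \<phi>')\<bar>) integrable_on {0..pi}"
    using assms(1,2) by (auto intro!: integrable_continuous_real continuous_intros)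
  have "integral {0..pi} (\<lambda>u. \<bar>sin (\<theta> u - \<phi>)\<bar>) \<le> integral {0..pi} (\<lambda>u. \<bar>sin (\<theta>' u - \<phi>')\<bar> + \<eta>)"
  proof (rule integral_le)
    fix u assume "u \<in> {0..pi}"
    then show "\<bar>sin (\<theta> u - \<phi>)\<bar> \<le> \<bar>sin (\<theta>' u - \<phi>')\<bar> + \<eta>"
      using assms(3)[of u] sin_lip[of "\<theta> u - \<phi>" "\<theta>' u - \<phi>'"] by linarith
  qed (use int in \<open>auto intro: integrable_add\<close>)
  also have "\<dots> = integral {0..pi} (\<lambda>u. \<bar>sin (\<theta>' u - \<phi>')\<bar>) + pi * \<eta>"
    using int by (subst integral_add) auto
  finally show ?thesis by (simp add: half_width_def)
qed

lemma measure_uminus_image: "measure lebesgue (uminus ` S) = measure lebesgue (S :: (real \<times> real) set)"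
  using measure_lebesgue_affine[of "- 1" 0 S] by simp

section \<open>The boundary curve of the body of a monotone half turn\<close>

text \<open>The geometric content of a competitor: everything about the shape of the body follows
  from continuity, monotonicity and a total turning of \<open>pi\<close>. Square integrability of
  the curvature enters separately through \<open>turning_density\<close>.\<close>

locale half_turn =
  fixes \<theta> :: "real \<Rightarrow> real"
  assumes cont: "continuous_on {0..pi} \<theta>"
    and mono: "\<And>s t. 0 \<le> s \<Longrightarrow> s \<le> t \<Longrightarrow> t \<le> pi \<Longrightarrow> \<theta> s \<le> \<theta> t"
    and turn: "\<theta> pi = \<theta> 0 + pi"
begin

lemma integrable:
  assumes "0 \<le> a" "b \<le> pi"
  shows "(\<lambda>u. sin (\<theta> u - \<phi>)) integrable_on {a..b}" "(\<lambda>u. \<bar>sin (\<theta> u - \<phi>)\<bar>) integrable_on {a..b}"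
    "(\<lambda>u. sin (\<theta> u)) integrable_on {a..b}" "(\<lambda>u. cos (\<theta> u)) integrable_on {a..b}"
proof -
  have "continuous_on {a..b} \<theta>"
    using cont assms by (auto intro: continuous_on_subset)
  then show "(\<lambda>u. sin (\<theta> u - \<phi>)) integrable_on {a..b}" "(\<lambda>u. \<bar>sin (\<theta> u - \<phi>)\<bar>) integrable_on {a..b}"
    "(\<lambda>u. sin (\<theta> u)) integrable_on {a..b}" "(\<lambda>u. cos (\<theta> u)) integrable_on {a..b}"
    by (auto intro!: integrable_continuous_real continuous_intros)
qed

lemma integral_sin_diff:
  assumes "0 \<le> a" "b \<le> pi"
  shows "integral {a..b} (\<lambda>u. sin (\<theta> u - \<phi>))
       = cos \<phi> * integral {a..b} (\<lambda>u. sin (\<theta> u)) - sin \<phi> * integral {a..b} (\<lambda>u. cos (\<theta> u))"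
proof -
  have "integral {a..b} (\<lambda>u. sin (\<theta> u - \<phi>))
      = integral {a..b} (\<lambda>u. cos \<phi> * sin (\<theta> u) - sin \<phi> * cos (\<theta> u))"
    by (simp add: sin_diff algebra_simps)
  also have "\<dots> = cos \<phi> * integral {a..b} (\<lambda>u. sin (\<theta> u)) - sin \<phi> * integral {a..b} (\<lambda>u. cos (\<theta> u))"
    using integrable[OF assms] by (subst integral_diff) (auto intro: integrable_on_mult_right)
  finally show ?thesis .
qed

lemma normal_coord_half_curve:
  assumes "0 \<le> t" "t \<le> pi"
  shows "normal_coord \<phi> (half_curve \<theta> t)
       = (integral {0..t} (\<lambda>u. sin (\<theta> u - \<phi>)) - integral {t..pi} (\<lambda>u. sin (\<theta> u - \<phi>))) / 2"
  using assms by (simp add: integral_sin_diff normal_coord_def half_curve_def) (simp add: field_simps)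

lemma half_width_split:
  assumes "0 \<le> t" "t \<le> pi"
  shows "half_width \<theta> \<phi>
       = (integral {0..t} (\<lambda>u. \<bar>sin (\<theta> u - \<phi>)\<bar>) + integral {t..pi} (\<lambda>u. \<bar>sin (\<theta> u - \<phi>)\<bar>)) / 2"
  unfolding half_width_def
  using Henstock_Kurzweil_Integration.integral_combine[OF assms integrable(2)] by simp

text \<open>A point of the half curve integrates \<open>sin (\<theta> u - \<phi>)\<close> with sign
  plus before \<open>t\<close> and minus after it, which is at most the integral of the absolute
  value.\<close>

lemma half_curve_in_sym_body:
  assumes "0 \<le> t" "t \<le> pi"
  shows "half_curve \<theta> t \<in> sym_body \<theta>"
  unfolding sym_body_def
proof clarify
  fix \<phi>
  have "\<bar>integral {a..b} (\<lambda>u. sin (\<theta> u - \<phi>))\<bar> \<le> integral {a..b} (\<lambda>u. \<bar>sin (\<theta> u - \<phi>)\<bar>)"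
    if "0 \<le> a" "b \<le> pi" for a b
    using integral_norm_bound_integral[OF integrable(1,2)[OF that]] by auto
  from this[of 0 t] this[of t pi] assms
  show "\<bar>normal_coord \<phi> (half_curve \<theta> t)\<bar> \<le> half_width \<theta> \<phi>"
    unfolding normal_coord_half_curve[OF assms] half_width_split[OF assms] by simp
qed

text \<open>In the direction \<open>\<theta> t\<close> the triangle inequality of the previous
  estimate is sharp: as the total turning is \<open>pi\<close>, the sine is nonpositive up to
  \<open>t\<close> and nonnegative from \<open>t\<close> on. So the tangent line at this point
  supports the body.\<close>

lemma normal_coord_half_curve_tangent:
  assumes "0 \<le> t" "t \<le> pi"
  shows "normal_coord (\<theta> t) (half_curve \<theta> t) = - half_width \<theta> (\<theta> t)"
proof -
  have ran: "\<theta> 0 \<le> \<theta> u" "\<theta> u \<le> \<theta> 0 + pi" if "0 \<le> u" "u \<le> pi" for u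
    using mono[of 0 u] mono[of u pi] turn that by auto
  have "sin (\<theta> u - \<theta> t) \<le> 0" if "u \<in> {0..t}" for u
    using ran[of u] ran[of t] mono[of u t] that assms sin_ge_zero[of "\<theta> t - \<theta> u"]
    by (auto simp: sin_diff algebra_simps)
  then have 1: "integral {0..t} (\<lambda>u. \<bar>sin (\<theta> u - \<theta> t)\<bar>) = integral {0..t} (\<lambda>u. - sin (\<theta> u - \<theta> t))"
    by (intro integral_cong) auto
  have "0 \<le> sin (\<theta> u - \<theta> t)" if "u \<in> {t..pi}" for u
    using ran[of u] ran[of t] mono[of t u] that assms by (auto intro!: sin_ge_zero)
  then have 2: "integral {t..pi} (\<lambda>u. \<bar>sin (\<theta> u - \<theta> t)\<bar>) = integral {t..pi} (\<lambda>u. sin (\<theta> u - \<theta> t))"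
    by (intro integral_cong) auto
  show ?thesis
    unfolding normal_coord_half_curve[OF assms] half_width_split[OF assms] 1 2
    by (simp add: field_simps)
qed

lemma half_curve_pi: "half_curve \<theta> pi = - half_curve \<theta> 0"
  by (simp add: half_curve_def)

lemma continuous_on_half_curve: "continuous_on {0..pi} (half_curve \<theta>)"
proof -
  have *: "continuous_on {0..pi} (\<lambda>t. integral {t..pi} (\<lambda>u. f (\<theta> u)))"
    if f: "\<And>a b. 0 \<le> a \<Longrightarrow> b \<le> pi \<Longrightarrow> (\<lambda>u. f (\<theta> u)) integrable_on {a..b}" for f :: "real \<Rightarrow> real"
    by (rule indefinite_integral_continuous_1'[OF f]) auto
  show ?thesis
    unfolding half_curve_def
    by (intro continuous_on_Pair continuous_on_divide continuous_on_diff
        indefinite_integral_continuous_1 * integrable continuous_on_const) auto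
qed

lemma half_width_pos: "0 < half_width \<theta> \<phi>"
proof -
  have nn: "0 \<le> half_width \<theta> \<phi>"
    by (simp add: half_width_def integral_nonneg integrable)
  have "half_width \<theta> \<phi> \<noteq> 0"
  proof
    assume "half_width \<theta> \<phi> = 0"
    then have "integral (cbox 0 pi) (\<lambda>u. \<bar>sin (\<theta> u - \<phi>)\<bar>) = 0"
      by (simp add: half_width_def)
    moreover have "continuous_on (cbox 0 pi) (\<lambda>u. \<bar>sin (\<theta> u - \<phi>)\<bar>)"
      using cont by (auto intro!: continuous_intros)
    ultimately have z: "sin (\<theta> u - \<phi>) = 0" if "u \<in> {0..pi}" for u
      using integral_cbox_eq_0_iff[of 0 pi "\<lambda>u. \<bar>sin (\<theta> u - \<phi>)\<bar>"] that pi_gt_zero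
      by (auto simp: not_le)
    \<comment> \<open>A quarter turn after the start the sine becomes the cosine of the starting
      difference, so sine and cosine would vanish together.\<close>
    obtain u where u: "0 \<le> u" "u \<le> pi" "\<theta> u = \<theta> 0 + pi / 2"
      using IVT'[of \<theta> 0 "\<theta> 0 + pi/2" pi] cont turn by auto
    have "sin (\<theta> 0 - \<phi>) = 0" "cos (\<theta> 0 - \<phi>) = 0"
      using z[of 0] z[of u] u sin_cos_eq[of "\<theta> 0 - \<phi>"] sin_add[of "\<theta> 0 - \<phi>" "pi/2"]
      by (auto simp: algebra_simps)
    then show False using sin_cos_squared_add[of "\<theta> 0 - \<phi>"] by simp
  qed
  with nn show ?thesis by simp
qed

lemma half_width_lower_bound: "\<exists>\<delta>>0. \<forall>\<phi>. \<delta> \<le> half_width \<theta> \<phi>"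
proof -
  have "continuous_on {0..2*pi} (half_width \<theta>)"
  proof (rule lipschitz_on_continuous_on)
    show "(pi/2)-lipschitz_on {0..2*pi} (half_width \<theta>)"
    proof (rule lipschitz_onI)
      fix x y
      have "half_width \<theta> x \<le> half_width \<theta> y + pi / 2 * \<bar>x - y\<bar>"
        "half_width \<theta> y \<le> half_width \<theta> x + pi / 2 * \<bar>x - y\<bar>"
        by (rule half_width_le_add[OF cont cont]; simp)+
      then show "dist (half_width \<theta> x) (half_width \<theta> y) \<le> pi / 2 * dist x y"
        unfolding dist_real_def by linarith
    qed simp
  qed
  then obtain m where m: "\<And>\<phi>. \<phi> \<in> {0..2*pi} \<Longrightarrow> half_width \<theta> m \<le> half_width \<theta> \<phi>"
    using continuous_attains_inf[of "{0..2*pi}" "half_width \<theta>"] by fastforce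
  have "half_width \<theta> m \<le> half_width \<theta> \<phi>" for \<phi>
  proof -
    define j where "j = \<lfloor>\<phi> / (2*pi)\<rfloor>"
    have "of_int j \<le> \<phi> / (2*pi)" "\<phi> / (2*pi) < of_int j + 1" by (auto simp: j_def)
    then have "\<phi> - of_int j * (2 * pi) \<in> {0..2*pi}"
      by (auto simp: field_simps)
    from m[OF this] show ?thesis by (simp only: half_width_shift)
  qed
  then show ?thesis using half_width_pos by blast
qed

lemma zero_in_interior_sym_body: "0 \<in> interior (sym_body \<theta>)"
proof -
  obtain \<delta> where \<delta>: "\<delta> > 0" "\<And>\<phi>. \<delta> \<le> half_width \<theta> \<phi>"
    using half_width_lower_bound by blast
  have "ball 0 \<delta> \<subseteq> sym_body \<theta>"
  proof
    fix p :: "real \<times> real" assume "p \<in> ball 0 \<delta>"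
    then have p: "norm p \<le> \<delta>" by (simp add: less_imp_le)
    show "p \<in> sym_body \<theta>"
      unfolding sym_body_def
    proof clarify
      show "\<bar>normal_coord \<phi> p\<bar> \<le> half_width \<theta> \<phi>" for \<phi>
        using p \<delta>(2)[of \<phi>] abs_normal_coord_le_norm[of \<phi> p] by linarith
    qed
  qed
  then show ?thesis
    using \<delta> by (meson centre_in_ball interiorI open_ball)
qed

text \<open>Moving the point outward by the factor \<open>1 + d\<close> leaves the strip in the
  direction \<open>\<theta> t\<close>, whose edge it already touches, although a small
  \<open>d\<close> would stay in a ball inside the body.\<close>

lemma half_curve_not_in_interior:
  assumes "0 \<le> t" "t \<le> pi"
  shows "half_curve \<theta> t \<notin> interior (sym_body \<theta>)"
proof
  assume "half_curve \<theta> t \<in> interior (sym_body \<theta>)"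
  then obtain e where e: "e > 0" "ball (half_curve \<theta> t) e \<subseteq> sym_body \<theta>"
    by (auto simp: mem_interior)
  define d where "d = e / (2 * (norm (half_curve \<theta> t) + 1))"
  have d: "d > 0" using e(1) by (simp add: d_def add_nonneg_pos)
  have "d * norm (half_curve \<theta> t) < e"
  proof -
    have "d * norm (half_curve \<theta> t) \<le> d * (norm (half_curve \<theta> t) + 1)"
      using d by (intro mult_left_mono) auto
    also have "\<dots> = e / 2" by (simp add: d_def field_simps add_nonneg_eq_0_iff)
    finally show ?thesis using e(1) by simp
  qed
  then have "half_curve \<theta> t + d *\<^sub>R half_curve \<theta> t \<in> ball (half_curve \<theta> t) e"
    using d by (simp add: dist_norm)
  with e(2) have "\<bar>normal_coord (\<theta> t) (half_curve \<theta> t + d *\<^sub>R half_curve \<theta> t)\<bar> \<le> half_width \<theta> (\<theta> t)"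
    by (auto simp: sym_body_def)
  moreover have "0 < d * half_width \<theta> (\<theta> t)" using d half_width_pos by simp
  ultimately show False
    unfolding normal_coord_simps normal_coord_half_curve_tangent[OF assms] by linarith
qed

text \<open>The ends of the half curve are opposite, so the half curve crosses every line through
  the centre. On such a line a frontier point and a curve point can differ only by sign, because
  proper shrinking toward the interior point 0 leads into the interior.\<close>

lemma frontier_sym_body:
  "frontier (sym_body \<theta>) = half_curve \<theta> ` {0..pi} \<union> (\<lambda>t. - half_curve \<theta> t) ` {0..pi}"
proof -
  have fr: "frontier (sym_body \<theta>) = sym_body \<theta> - interior (sym_body \<theta>)"
    using compact_sym_body by (simp add: frontier_def compact_imp_closed)
  have shrink: "c *\<^sub>R p \<in> interior (sym_body \<theta>)" if "p \<in> sym_body \<theta>" "\<bar>c\<bar> < 1" for p c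
  proof -
    have "\<bar>c\<bar> *\<^sub>R p \<in> interior (sym_body \<theta>)"
      using mem_interior_convex_shrink[OF convex_sym_body zero_in_interior_sym_body that(1), of "1 - \<bar>c\<bar>"] that(2)
      by (simp add: algebra_simps)
    then show ?thesis
      using interior_sym_body_uminus[of "c *\<^sub>R p" \<theta>] by (cases "c \<ge> 0") auto
  qed
  show ?thesis
  proof (intro equalityI subsetI)
    fix p assume p: "p \<in> frontier (sym_body \<theta>)"
    then have pb: "p \<in> sym_body \<theta>" "p \<notin> interior (sym_body \<theta>)" by (auto simp: fr)
    then have "p \<noteq> 0" using zero_in_interior_sym_body by auto
    define f where "f t = cross p (half_curve \<theta> t)" for t
    have contf: "continuous_on {0..pi} f"
      unfolding f_def cross_def by (intro continuous_intros continuous_on_half_curve)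
    have "f pi = - f 0" by (simp add: f_def half_curve_pi cross_simps)
    then have "\<exists>t. 0 \<le> t \<and> t \<le> pi \<and> f t = 0"
      using IVT'[OF _ _ _ contf, of 0] IVT2'[OF _ _ _ contf, of 0] by (cases "f 0 \<le> 0") auto
    then obtain t where t: "0 \<le> t" "t \<le> pi" "f t = 0" by blast
    then obtain c where c: "half_curve \<theta> t = c *\<^sub>R p"
      using cross_zero_imp_multiple[OF _ \<open>p \<noteq> 0\<close>] unfolding f_def by blast
    have "\<not> \<bar>c\<bar> < 1"
      using shrink[OF pb(1), of c] half_curve_not_in_interior[OF t(1,2)] c by auto
    moreover have "\<not> \<bar>c\<bar> > 1"
    proof
      assume "\<bar>c\<bar> > 1"
      then have "p = (1/c) *\<^sub>R half_curve \<theta> t" "\<bar>1/c\<bar> < 1" using c by auto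
      then show False
        using shrink[OF half_curve_in_sym_body[OF t(1,2)], of "1/c"] pb(2) by auto
    qed
    ultimately have "c = 1 \<or> c = - 1" by linarith
    then show "p \<in> half_curve \<theta> ` {0..pi} \<union> (\<lambda>t. - half_curve \<theta> t) ` {0..pi}"
      using c t by force
  next
    fix p assume "p \<in> half_curve \<theta> ` {0..pi} \<union> (\<lambda>t. - half_curve \<theta> t) ` {0..pi}"
    then show "p \<in> frontier (sym_body \<theta>)"
      unfolding fr
      using half_curve_in_sym_body half_curve_not_in_interior
      by (auto simp only: interior_sym_body_uminus sym_body_uminus Diff_iff atLeastAtMost_iff Un_iff image_iff)
  qed
qed

section \<open>Area of the body against the hull of its half curve\<close>

text \<open>The arc stays on one side of its chord. If \<open>I\<close> and \<open>II\<close> are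
  the displacements along the two subarcs separated at \<open>t\<close>, the cross product equals
  half of \<open>I\<close> times \<open>II\<close>, which is the double integral of
  \<open>sin (\<theta> v - \<theta> u)\<close> over \<open>u \<le> t \<le> v\<close>; there the
  angle difference lies between 0 and \<open>pi\<close>.\<close>

lemma cross_half_curve_nonneg:
  assumes "0 \<le> t" "t \<le> pi"
  shows "0 \<le> cross (half_curve \<theta> 0) (half_curve \<theta> t)"
proof -
  define Ic Is IIc IIs where I: "Ic = integral {0..t} (\<lambda>u. cos (\<theta> u))" "Is = integral {0..t} (\<lambda>u. sin (\<theta> u))"
    "IIc = integral {t..pi} (\<lambda>u. cos (\<theta> u))" "IIs = integral {t..pi} (\<lambda>u. sin (\<theta> u))"
  have "integral {0..pi} (\<lambda>u. cos (\<theta> u)) = Ic + IIc" "integral {0..pi} (\<lambda>u. sin (\<theta> u)) = Is + IIs"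
    unfolding I by (rule Henstock_Kurzweil_Integration.integral_combine[symmetric] integrable assms order_refl)+
  then have "cross (half_curve \<theta> 0) (half_curve \<theta> t) = (Ic * IIs - Is * IIc) / 2"
    by (simp add: cross_def half_curve_def I[symmetric] field_simps)
  moreover have "0 \<le> Ic * IIs - Is * IIc"
  proof -
    have "0 \<le> integral {0..t} (\<lambda>u. integral {t..pi} (\<lambda>v. sin (\<theta> v - \<theta> u)))"
    proof (rule integral_nonneg)
      have eq: "integral {t..pi} (\<lambda>v. sin (\<theta> v - \<theta> u)) = cos (\<theta> u) * IIs - sin (\<theta> u) * IIc" for u
        using integral_sin_diff[of t pi "\<theta> u"] assms by (simp add: I)
      show "(\<lambda>u. integral {t..pi} (\<lambda>v. sin (\<theta> v - \<theta> u))) integrable_on {0..t}"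
        unfolding eq using assms by (intro integrable_diff integrable_on_mult_left integrable) auto
      fix u assume u: "u \<in> {0..t}"
      show "0 \<le> integral {t..pi} (\<lambda>v. sin (\<theta> v - \<theta> u))"
      proof (rule integral_nonneg)
        fix v assume "v \<in> {t..pi}"
        then show "0 \<le> sin (\<theta> v - \<theta> u)"
          using u assms mono[of u v] mono[of 0 u] mono[of v pi] turn by (auto intro!: sin_ge_zero)
      qed (use assms integrable in auto)
    qed
    also have "\<dots> = integral {0..t} (\<lambda>u. cos (\<theta> u) * IIs - sin (\<theta> u) * IIc)"
      using integral_sin_diff[of t pi] assms by (simp add: I)
    also have "\<dots> = Ic * IIs - Is * IIc"
      using assms by (subst integral_diff) (auto simp: I intro: integrable_on_mult_left integrable)
    finally show ?thesis .
  qed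
  ultimately show ?thesis by simp
qed

lemma half_curve_0_nonzero: "half_curve \<theta> 0 \<noteq> 0"
  using normal_coord_half_curve_tangent[of 0] half_width_pos[of "\<theta> 0"]
  by (auto simp: normal_coord_simps)

abbreviation half_hull where "half_hull \<equiv> convex hull (half_curve \<theta> ` {0..pi})"

lemma compact_half_hull: "compact half_hull"
  by (intro compact_convex_hull compact_continuous_image continuous_on_half_curve compact_Icc)

lemma cross_half_hull_nonneg: "p \<in> half_hull \<Longrightarrow> 0 \<le> cross (half_curve \<theta> 0) p"
  using hull_minimal[of "half_curve \<theta> ` {0..pi}" "{x. 0 \<le> cross (half_curve \<theta> 0) x}" convex]
    cross_half_curve_nonneg convex_cross_ge by fastforce

lemma half_hull_subset: "half_hull \<subseteq> sym_body \<theta>"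
  using half_curve_in_sym_body by (intro hull_minimal convex_sym_body) auto

text \<open>A segment from the half hull to its reflection crosses the line of the common chord, and it
  does so within the chord because the body lies in the strip between the parallel tangents at the
  ends of the chord.\<close>
lemma sym_body_subset_half_hulls: "sym_body \<theta> \<subseteq> half_hull \<union> uminus ` half_hull"
proof
  fix p assume "p \<in> sym_body \<theta>"
  let ?a = "half_curve \<theta> 0"
  have "sym_body \<theta> = convex hull (half_curve \<theta> ` {0..pi} \<union> uminus ` half_curve \<theta> ` {0..pi})"
    using Krein_Milman_frontier[OF convex_sym_body[of \<theta>] compact_sym_body]
    unfolding frontier_sym_body image_image .
  also have "\<dots> \<subseteq> convex hull (half_hull \<union> uminus ` half_hull)"
    by (intro hull_mono Un_mono image_mono hull_subset)
  also have "\<dots> = {u *\<^sub>R s + v *\<^sub>R t |u v s t. 0 \<le> u \<and> 0 \<le> v \<and> u + v = 1 \<and> s \<in> half_hull \<and> t \<in> uminus ` half_hull}"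
    by (rule convex_hull_union_two) (auto intro!: convex_negations)
  finally obtain u v s t where uv: "0 \<le> u" "0 \<le> v" "u + v = 1" and s: "s \<in> half_hull" and t: "t \<in> half_hull"
    and p: "p = u *\<^sub>R s + v *\<^sub>R (- t)"
    using \<open>p \<in> sym_body \<theta>\<close> by blast
  have a: "?a \<in> half_hull" "- ?a \<in> half_hull"
    unfolding half_curve_pi[symmetric] by (auto intro!: hull_inc imageI)
  define \<alpha> \<beta> where ab: "\<alpha> = cross ?a s" "\<beta> = cross ?a t"
  have nn: "0 \<le> \<alpha>" "0 \<le> \<beta>" unfolding ab using cross_half_hull_nonneg s t by auto
  \<comment> \<open>The weights balance the heights \<open>\<alpha>\<close> and
    \<open>\<beta>\<close> of \<open>s\<close> and \<open>t\<close> over the chord, which puts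
    \<open>q\<close> on the line of the chord. If both heights vanish, the whole segment lies on
    that line and \<open>q = s\<close> will do.\<close>
  obtain x y where xy: "0 \<le> x" "0 \<le> y" "x + y = 1" "x * \<alpha> = y * \<beta>"
  proof (cases "\<alpha> + \<beta> = 0")
    case True
    then show ?thesis using that[of 1 0] nn by auto
  next
    case False
    then show ?thesis
      using nn by (intro that[of "\<beta> / (\<alpha> + \<beta>)" "\<alpha> / (\<alpha> + \<beta>)"]) (auto simp: add_divide_distrib[symmetric])
  qed
  define q where "q = x *\<^sub>R s + y *\<^sub>R (- t)"
  have "cross ?a q = 0" using xy by (simp only: q_def cross_simps ab[symmetric])
  then obtain c where c: "q = c *\<^sub>R ?a"
    using cross_zero_imp_multiple half_curve_0_nonzero by blast
  have "q \<in> sym_body \<theta>"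
    unfolding q_def using convexD[OF convex_sym_body, of s \<theta> "- t" x y] half_hull_subset s t xy
      sym_body_uminus by blast
  then have "\<bar>normal_coord (\<theta> 0) q\<bar> \<le> half_width \<theta> (\<theta> 0)" by (simp add: sym_body_def)
  then have "\<bar>c\<bar> * half_width \<theta> (\<theta> 0) \<le> 1 * half_width \<theta> (\<theta> 0)"
    using half_width_pos[of "\<theta> 0"]
    by (simp only: c normal_coord_simps) (simp add: normal_coord_half_curve_tangent abs_mult)
  then have "\<bar>c\<bar> \<le> 1" using half_width_pos[of "\<theta> 0"] by (simp only: mult_le_cancel_right_pos)
  \<comment> \<open>These convex combinations of the two chord ends are \<open>q\<close> and
    \<open>- q\<close>.\<close>
  then have "((1 + c) / 2) *\<^sub>R ?a + ((1 - c) / 2) *\<^sub>R (- ?a) \<in> half_hull"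
    "((1 - c) / 2) *\<^sub>R ?a + ((1 + c) / 2) *\<^sub>R (- ?a) \<in> half_hull"
    by (intro convexD[OF convex_convex_hull a]; simp add: field_simps)+
  moreover have "((1 + c) / 2) *\<^sub>R ?a + ((1 - c) / 2) *\<^sub>R (- ?a) = q"
     "((1 - c) / 2) *\<^sub>R ?a + ((1 + c) / 2) *\<^sub>R (- ?a) = - q"
    by (simp_all add: c scaleR_left_diff_distrib[symmetric] flip: scaleR_minus_left)
       (simp_all add: field_simps flip: scaleR_left.add scaleR_left.diff)
  ultimately have q: "q \<in> half_hull" "- q \<in> half_hull" by auto
  show "p \<in> half_hull \<union> uminus ` half_hull"
  \<comment> \<open>Both \<open>p\<close> and \<open>q\<close> lie on the segment from
    \<open>s\<close> to \<open>- t\<close>, with weights \<open>u\<close> and \<open>x\<close> of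
    \<open>s\<close>. Comparing the weights tells whether \<open>p\<close> lies between
    \<open>s\<close> and \<open>q\<close>, or \<open>- p\<close> lies between \<open>t\<close> and
    \<open>- q\<close>.\<close>
  proof (cases "x \<le> u")
    case True
    show ?thesis
    proof (cases "y = 0")
      case True
      then have "u = 1" "v = 0" using xy uv \<open>x \<le> u\<close> by auto
      then show ?thesis using p s by simp
    next
      case False
      then have "y > 0" using xy by simp
      have "p = ((y - v) / y) *\<^sub>R s + (v / y) *\<^sub>R q"
      proof -
        have "(y - v) / y + v / y * x = u"
          using \<open>y > 0\<close> xy uv by (simp add: field_simps) algebra
        moreover have "p = u *\<^sub>R s - v *\<^sub>R t" by (simp add: p)
        moreover have "((y - v) / y) *\<^sub>R s + (v / y) *\<^sub>R q = ((y - v) / y + v / y * x) *\<^sub>R s - v *\<^sub>R t"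
          using \<open>y > 0\<close> by (simp add: q_def algebra_simps)
        ultimately show ?thesis by simp
      qed
      moreover have "\<dots> \<in> half_hull"
        using True xy uv \<open>y > 0\<close> by (intro convexD[OF convex_convex_hull s q(1)]) (auto simp: field_simps)
      ultimately show ?thesis by simp
    qed
  next
    case False
    then have "x > 0" using uv by simp
    have "- p = ((x - u) / x) *\<^sub>R t + (u / x) *\<^sub>R (- q)"
    proof -
      have "(x - u) / x + u / x * y = v"
        using \<open>x > 0\<close> xy uv by (simp add: field_simps) algebra
      moreover have "- p = v *\<^sub>R t - u *\<^sub>R s" by (simp add: p)
      moreover have "((x - u) / x) *\<^sub>R t + (u / x) *\<^sub>R (- q) = ((x - u) / x + u / x * y) *\<^sub>R t - u *\<^sub>R s"
        using \<open>x > 0\<close> by (simp add: q_def algebra_simps)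
      ultimately show ?thesis by simp
    qed
    moreover have "\<dots> \<in> half_hull"
      using False xy uv \<open>x > 0\<close> by (intro convexD[OF convex_convex_hull t q(2)]) (auto simp: field_simps)
    ultimately have "- p \<in> half_hull" by simp
    then show ?thesis by (metis UnI2 add.inverse_inverse image_eqI)
  qed
qed

text \<open>Subadditivity on the covering by two congruent hulls; symmetrization has to bound the
  area of the completed body from above.\<close>

lemma measure_sym_body_le: "measure lebesgue (sym_body \<theta>) \<le> 2 * measure lebesgue half_hull"
proof -
  have lm: "half_hull \<in> lmeasurable" "uminus ` half_hull \<in> lmeasurable"
    using compact_half_hull by (auto intro: lmeasurable_compact compact_negations)
  have "measure lebesgue (sym_body \<theta>) \<le> measure lebesgue (half_hull \<union> uminus ` half_hull)"
    using sym_body_subset_half_hulls lm compact_sym_body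
    by (intro measure_mono_fmeasurable) (auto intro: lmeasurable_compact fmeasurableD fmeasurable.Un)
  also have "\<dots> \<le> measure lebesgue half_hull + measure lebesgue (uminus ` half_hull)"
    using lm by (intro measure_Un_le) (auto intro: fmeasurableD)
  finally show ?thesis by (simp add: measure_uminus_image)
qed

end

subsection \<open>Limits of square-integrable densities\<close>

lemma integrable_mult_of_squares:
  fixes f g :: "'a \<Rightarrow> real"
  assumes [measurable]: "f \<in> borel_measurable M" "g \<in> borel_measurable M"
    and sq: "integrable M (\<lambda>x. (f x)\<^sup>2)" "integrable M (\<lambda>x. (g x)\<^sup>2)"
  shows "integrable M (\<lambda>x. f x * g x)"
proof (rule Bochner_Integration.integrable_bound[OF Bochner_Integration.integrable_add[OF sq]])
  have "\<bar>a * b\<bar> \<le> a\<^sup>2 + b\<^sup>2" for a b :: real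
  proof -
    have "2 * \<bar>a * b\<bar> \<le> a\<^sup>2 + b\<^sup>2"
      using zero_le_power2[of "\<bar>a\<bar> - \<bar>b\<bar>"] by (simp add: power2_diff abs_mult)
    then show ?thesis using abs_ge_zero[of "a * b"] by linarith
  qed
  then show "AE x in M. norm (f x * g x) \<le> norm ((f x)\<^sup>2 + (g x)\<^sup>2)" by simp
qed measurable

lemma (in finite_measure) integrable_of_square:
  fixes f :: "'a \<Rightarrow> real"
  assumes "f \<in> borel_measurable M" "integrable M (\<lambda>x. (f x)\<^sup>2)"
  shows "integrable M f"
  using integrable_mult_of_squares[OF assms(1) _ assms(2), of "\<lambda>_. 1"] by simp

text \<open>Applied to squares it bounds the energy of an almost everywhere limit; applied to
  distances from a fixed term it turns a Cauchy estimate in L1 into a distance to the limit.\<close>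

lemma fatou_le:
  fixes f :: "nat \<Rightarrow> 'a \<Rightarrow> real"
  assumes int: "\<And>i. integrable M (f i)" and nn: "\<And>i x. 0 \<le> f i x"
    and [measurable]: "g \<in> borel_measurable M"
    and lim: "AE x in M. (\<lambda>i. f i x) \<longlonglongrightarrow> g x"
    and le: "eventually (\<lambda>i. integral\<^sup>L M (f i) \<le> C) sequentially"
  shows "integrable M g" "integral\<^sup>L M g \<le> C"
proof -
  have gnn: "AE x in M. 0 \<le> g x"
    using lim by eventually_elim (use nn in \<open>auto intro: LIMSEQ_le_const\<close>)
  have C: "0 \<le> C"
  proof -
    obtain i where "integral\<^sup>L M (f i) \<le> C" using eventually_happens'[OF sequentially_bot le] by blast
    moreover have "0 \<le> integral\<^sup>L M (f i)" using nn by simp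
    ultimately show ?thesis by linarith
  qed
  have [measurable]: "f i \<in> borel_measurable M" for i using int by auto
  have "(\<integral>\<^sup>+ x. ennreal (g x) \<partial>M) = (\<integral>\<^sup>+ x. liminf (\<lambda>i. ennreal (f i x)) \<partial>M)"
  proof (rule nn_integral_cong_AE)
    show "AE x in M. ennreal (g x) = liminf (\<lambda>i. ennreal (f i x))"
      using lim
    proof eventually_elim
      case (elim x)
      then have "(\<lambda>i. ennreal (f i x)) \<longlonglongrightarrow> ennreal (g x)" by (rule tendsto_ennrealI)
      then show ?case using lim_imp_Liminf[OF sequentially_bot] by metis
    qed
  qed
  also have "\<dots> \<le> liminf (\<lambda>i. \<integral>\<^sup>+ x. ennreal (f i x) \<partial>M)"
    by (rule nn_integral_liminf) measurable
  also have "\<dots> \<le> ennreal C"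
  proof -
    have "eventually (\<lambda>i. (\<integral>\<^sup>+ x. ennreal (f i x) \<partial>M) \<le> ennreal C) sequentially"
      using le by eventually_elim (simp add: nn_integral_eq_integral int nn ennreal_leI)
    then have "liminf (\<lambda>i. \<integral>\<^sup>+ x. ennreal (f i x) \<partial>M) \<le> liminf (\<lambda>i::nat. ennreal C)"
      by (rule Liminf_mono)
    then show ?thesis by (simp add: Liminf_const)
  qed
  finally have *: "(\<integral>\<^sup>+ x. ennreal (g x) \<partial>M) \<le> ennreal C" .
  then show 1: "integrable M g"
    using gnn by (intro integrableI_nonneg) (auto intro: le_less_trans)
  show "integral\<^sup>L M g \<le> C"
    using * C by (simp add: nn_integral_eq_integral[OF 1 gnn] ennreal_le_iff)
qed

text \<open>Near-minimisers of the square norm over the shrinking convex sets of approximate solutions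
  form a Cauchy sequence by the parallelogram identity, which replaces weak compactness.\<close>
lemma (in finite_measure) square_integrable_limit:
  fixes \<psi> :: "'s \<Rightarrow> real"
  assumes A[measurable]: "\<And>s. s \<in> S \<Longrightarrow> A s \<in> sets M"
    and ex: "\<And>\<epsilon>. \<epsilon> > 0 \<Longrightarrow> \<exists>k\<in>borel_measurable M. (\<forall>x. 0 \<le> k x) \<and> integrable M (\<lambda>x. (k x)\<^sup>2) \<and>
        (LINT x|M. (k x)\<^sup>2) \<le> B + \<epsilon> \<and> (\<forall>s\<in>S. \<bar>(LINT x:A s|M. k x) - \<psi> s\<bar> \<le> \<epsilon>)"
  shows "\<exists>k\<in>borel_measurable M. (\<forall>x. 0 \<le> k x) \<and> integrable M (\<lambda>x. (k x)\<^sup>2) \<and>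
        (LINT x|M. (k x)\<^sup>2) \<le> B \<and> (\<forall>s\<in>S. (LINT x:A s|M. k x) = \<psi> s)"
proof -
  \<comment> \<open>The approximate solutions with tolerance \<open>1 / Suc n\<close> form
    decreasing convex sets, so the infima \<open>d n\<close> of the square norm increase; they stay
    below \<open>B\<close> and hence converge.\<close>
  define P :: "nat \<Rightarrow> ('a \<Rightarrow> real) \<Rightarrow> bool" where
    "P n k \<longleftrightarrow> k \<in> borel_measurable M \<and> (\<forall>x. 0 \<le> k x) \<and> integrable M (\<lambda>x. (k x)\<^sup>2) \<and>
      (\<forall>s\<in>S. \<bar>(LINT x:A s|M. k x) - \<psi> s\<bar> \<le> 1 / Suc n)" for n k
  define N where "N k = (LINT x|M. (k x)\<^sup>2)" for k :: "'a \<Rightarrow> real"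
  define d where "d n = Inf (N ` Collect (P n))" for n
  have bdd: "bdd_below (N ` X)" for X
    by (rule bdd_belowI[of _ 0]) (auto simp: N_def)
  have d_le: "d n \<le> N k" if "P n k" for n k
    unfolding d_def using that by (intro cInf_lower bdd) auto
  have ex': "\<exists>k. P n k \<and> N k \<le> B + \<epsilon>" if "\<epsilon> > 0" for n \<epsilon>
  proof -
    have "min \<epsilon> (1 / Suc n) > 0" using that by simp
    from ex[OF this] obtain k where "k \<in> borel_measurable M" "\<forall>x. 0 \<le> k x" "integrable M (\<lambda>x. (k x)\<^sup>2)"
      "N k \<le> B + min \<epsilon> (1 / Suc n)" "\<forall>s\<in>S. \<bar>(LINT x:A s|M. k x) - \<psi> s\<bar> \<le> min \<epsilon> (1 / Suc n)"
      unfolding N_def by blast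
    then have "P n k" "N k \<le> B + \<epsilon>" by (auto simp: P_def)
    then show ?thesis by blast
  qed
  have P_mono: "P n k" if "P m k" "n \<le> m" for n m k
  proof -
    have "1 / real (Suc m) \<le> 1 / real (Suc n)" using that(2) by (simp add: frac_le)
    then show ?thesis using that(1) unfolding P_def by (meson order_trans)
  qed
  have d_B: "d n \<le> B" for n
  proof (rule field_le_epsilon)
    fix e :: real assume "e > 0"
    then obtain k where "P n k" "N k \<le> B + e" using ex' by blast
    then show "d n \<le> B + e" using d_le[of n k] by linarith
  qed
  have "incseq d"
    unfolding incseq_def d_def
  proof (intro allI impI cInf_superset_mono bdd image_mono)
    show "N ` Collect (P m) \<noteq> {}" for m using ex'[OF zero_less_one, of m] by blast
    show "Collect (P m) \<subseteq> Collect (P n)" if "n \<le> m" for n m using P_mono that by blast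
  qed
  then obtain D where D: "d \<longlonglongrightarrow> D"
    using d_B incseq_convergent[of d B] by blast
  have "\<exists>g. P n g \<and> N g < d n + 1 / Suc n" for n
  proof -
    have "Inf (N ` Collect (P n)) < d n + 1 / Suc n" by (simp add: d_def)
    then show ?thesis
      using cInf_lessD[of "N ` Collect (P n)"] ex'[OF zero_less_one, of n] by blast
  qed
  then obtain g where g: "\<And>n. P n (g n)" "\<And>n. N (g n) < d n + 1 / Suc n" by metis
  have gm[measurable]: "g n \<in> borel_measurable M" and gnn: "\<And>x. 0 \<le> g n x"
    and gsq: "integrable M (\<lambda>x. (g n x)\<^sup>2)" for n
    using g(1)[of n] by (auto simp: P_def)
  have gi: "integrable M (g n)" for n by (rule integrable_of_square[OF gm gsq])
  have gA: "\<bar>(LINT x:A s|M. g n x) - \<psi> s\<bar> \<le> 1 / Suc n" if "s \<in> S" for s n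
    using g(1)[of n] that by (auto simp: P_def)
  have gAi: "set_integrable M (A s) (g n)" if "s \<in> S" for s n
    unfolding set_integrable_def using gi A[OF that] by (intro integrable_mult_indicator)
  have prod: "integrable M (\<lambda>x. g n x * g m x)" for n m
    by (rule integrable_mult_of_squares[OF gm gm gsq gsq])
  have diffsq: "integrable M (\<lambda>x. (g n x - g m x)\<^sup>2)" for n m
    unfolding power2_diff using prod[of n m] gsq
    by (auto intro!: Bochner_Integration.integrable_add Bochner_Integration.integrable_diff simp: mult.assoc)
  \<comment> \<open>The midpoint \<open>h\<close> of \<open>g n\<close> and \<open>g m\<close> is
    again in the set of index \<open>n\<close>, so \<open>N h\<close> is at least
    \<open>d n\<close>. Inserting this and the near-minimality of both functions into the
    parallelogram identity gives the bound.\<close>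
  have par: "N (\<lambda>x. g n x - g m x) \<le> 2 * (d m - d n) + 4 / Suc n" if "n \<le> m" for n m
  proof -
    define h where "h x = (g n x + g m x) / 2" for x
    have hsq: "(\<lambda>x. (h x)\<^sup>2) = (\<lambda>x. (g n x)\<^sup>2 / 4 + (g m x)\<^sup>2 / 4 + g n x * g m x / 2)"
      by (auto simp: h_def power2_eq_square field_simps)
    have "P n h"
      unfolding P_def
    proof (intro conjI ballI allI)
      show "h \<in> borel_measurable M" unfolding h_def by measurable
      show "0 \<le> h x" for x using gnn by (simp add: h_def)
      show "integrable M (\<lambda>x. (h x)\<^sup>2)"
        unfolding hsq using prod[of n m] gsq by auto
      fix s assume s: "s \<in> S"
      have "(LINT x:A s|M. h x) = ((LINT x:A s|M. g n x) + (LINT x:A s|M. g m x)) / 2"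
        unfolding h_def using gAi[OF s] by (simp add: set_integral_add)
      moreover have "\<bar>(LINT x:A s|M. g m x) - \<psi> s\<bar> \<le> 1 / Suc n"
        using P_mono[OF g(1)[of m] that] s by (auto simp: P_def)
      ultimately show "\<bar>(LINT x:A s|M. h x) - \<psi> s\<bar> \<le> 1 / Suc n"
        using gA[OF s, of n] unfolding abs_le_iff by argo
    qed
    then have "d n \<le> N h" by (rule d_le)
    also have "N h = N (g n) / 4 + N (g m) / 4 + (LINT x|M. g n x * g m x) / 2"
      unfolding N_def hsq using prod[of n m] gsq by simp
    finally have 1: "d n \<le> \<dots>" .
    have "N (\<lambda>x. g n x - g m x) = (LINT x|M. (g n x)\<^sup>2 + (g m x)\<^sup>2 - 2 * (g n x * g m x))"
      by (simp add: N_def power2_diff mult.assoc)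
    also have "\<dots> = N (g n) + N (g m) - 2 * (LINT x|M. g n x * g m x)"
      using prod[of n m] gsq by (simp add: N_def)
    finally have 2: "N (\<lambda>x. g n x - g m x) = \<dots>" .
    have "1 / real (Suc m) \<le> 1 / real (Suc n)" using that by (simp add: frac_le)
    moreover have "4 / real (Suc n) = 4 * (1 / real (Suc n))" by simp
    ultimately show ?thesis using 1 2 g(2)[of n] g(2)[of m] by argo
  qed
  \<comment> \<open>Integrating \<open>\<bar>x\<bar> \<le> l * x\<^sup>2 + 1 / l\<close> passes from
    the square norm to L1 on a finite measure space; the parameter \<open>l\<close> is chosen later
    to balance the terms.\<close>
  have L1: "(LINT x|M. norm (g i x - g j x)) \<le> l * N (\<lambda>x. g i x - g j x) + measure M (space M) / l"
    if "l > 0" for i j l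
  proof -
    have "(LINT x|M. norm (g i x - g j x)) \<le> (LINT x|M. l * (g i x - g j x)\<^sup>2 + 1 / l)"
    proof (rule integral_mono)
      show "norm (g i x - g j x) \<le> l * (g i x - g j x)\<^sup>2 + 1 / l" for x
      proof -
        have "2 * \<bar>g i x - g j x\<bar> \<le> l * (g i x - g j x)\<^sup>2 + 1 / l"
          using zero_le_power2[of "l * \<bar>g i x - g j x\<bar> - 1"] that
          by (simp add: power2_diff power_mult_distrib field_simps power2_eq_square)
        then show ?thesis using abs_ge_zero[of "g i x - g j x"] unfolding real_norm_def by argo
      qed
    qed (use gi diffsq in auto)
    also have "\<dots> = l * N (\<lambda>x. g i x - g j x) + measure M (space M) / l"
      using diffsq[of i j] by (simp add: N_def)
    finally show ?thesis .
  qed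
  have Cauchy: "\<exists>K. \<forall>i\<ge>K. \<forall>j\<ge>K. (LINT x|M. norm (g i x - g j x)) < e" if "e > 0" for e
  proof -
    \<comment> \<open>Makes the measure term smaller than \<open>e / 2\<close>; the added 1 keeps
      \<open>l\<close> positive on a null space.\<close>
    define l where "l = 2 * (measure M (space M) + 1) / e"
    have l: "l > 0" using that by (simp add: l_def add_nonneg_pos)
    have ml: "measure M (space M) / l < e / 2"
    proof -
      have "measure M (space M) < (e / 2) * l" using that by (simp add: l_def)
      then show ?thesis using l by (simp add: pos_divide_less_eq)
    qed
    have "(\<lambda>n. 2 * (D - d n) + 4 / Suc n) \<longlonglongrightarrow> 2 * (D - D) + 0"
      by (intro tendsto_intros D LIMSEQ_Suc[OF lim_const_over_n])
    then have "eventually (\<lambda>n. 2 * (D - d n) + 4 / Suc n < e / (2 * l)) sequentially"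
      using that l by (intro order_tendstoD(2)) auto
    then obtain K where K: "\<And>n. n \<ge> K \<Longrightarrow> 2 * (D - d n) + 4 / Suc n < e / (2 * l)"
      by (auto simp: eventually_sequentially)
    have dD: "d m \<le> D" for m by (rule incseq_le[OF \<open>incseq d\<close> D])
    have *: "(LINT x|M. norm (g i x - g j x)) < e" if "K \<le> i" "i \<le> j" for i j
    proof -
      have "N (\<lambda>x. g i x - g j x) < e / (2 * l)"
        using par[OF that(2)] K[OF that(1)] dD[of j] by argo
      then have "l * N (\<lambda>x. g i x - g j x) < e / 2" using l by (simp add: field_simps)
      then show ?thesis using L1[OF l, of i j] ml by argo
    qed
    have "(LINT x|M. norm (g i x - g j x)) < e" if "K \<le> i" "K \<le> j" for i j
      using *[of i j] *[of j i] that by (cases "i \<le> j") (auto simp: abs_minus_commute)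
    then show ?thesis by blast
  qed
  obtain r where r: "strict_mono r" "AE x in M. Cauchy (\<lambda>i. g (r i) x)"
    using cauchy_L1_AE_cauchy_subseq[OF gi Cauchy] by blast
  \<comment> \<open>The maximum secures nonnegativity everywhere, also on the null set where the
    subsequence has no limit.\<close>
  define k where "k x = max 0 (lim (\<lambda>i. g (r i) x))" for x
  have [measurable]: "k \<in> borel_measurable M"
    unfolding k_def by measurable
  have kl: "AE x in M. (\<lambda>i. g (r i) x) \<longlonglongrightarrow> k x"
    using r(2)
  proof eventually_elim
    case (elim x)
    then have *: "(\<lambda>i. g (r i) x) \<longlonglongrightarrow> lim (\<lambda>i. g (r i) x)"
      by (simp add: Cauchy_convergent convergent_LIMSEQ_iff[symmetric])
    then have "0 \<le> lim (\<lambda>i. g (r i) x)" using gnn by (intro LIMSEQ_le_const) auto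
    then show ?case using * by (simp add: k_def)
  qed
  have Nr: "N (g (r i)) \<le> B + e" if "1 / Suc i < e" for e i
  proof -
    have "1 / real (Suc (r i)) \<le> 1 / Suc i" using seq_suble[OF r(1), of i] by (simp add: frac_le)
    then show ?thesis using g(2)[of "r i"] d_B[of "r i"] that by argo
  qed
  have small: "eventually (\<lambda>i. 1 / real (Suc i) < e) sequentially" if "e > 0" for e
    using order_tendstoD(2)[OF LIMSEQ_Suc[OF lim_const_over_n[of 1]] that] by simp
  have ksq: "integrable M (\<lambda>x. (k x)\<^sup>2) \<and> N k \<le> B + e" if "e > 0" for e
  proof -
    have "AE x in M. (\<lambda>i. (g (r i) x)\<^sup>2) \<longlonglongrightarrow> (k x)\<^sup>2"
      using kl by eventually_elim (intro tendsto_intros)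
    moreover have "eventually (\<lambda>i. (LINT x|M. (g (r i) x)\<^sup>2) \<le> B + e) sequentially"
      using small[OF that] by eventually_elim (use Nr in \<open>auto simp: N_def\<close>)
    ultimately show ?thesis
      using fatou_le[of M "\<lambda>i x. (g (r i) x)\<^sup>2" "\<lambda>x. (k x)\<^sup>2" "B + e"] gsq by (auto simp: N_def)
  qed
  have kint: "integrable M k"
    by (rule integrable_of_square) (use ksq[OF zero_less_one] in simp_all)
  have "(LINT x:A s|M. k x) = \<psi> s" if s: "s \<in> S" for s
  proof -
    \<comment> \<open>For a fixed late index \<open>i\<close>, Fatou bounds the L1 distance of
      \<open>k\<close> from \<open>g (r i)\<close> by \<open>e / 2\<close>, and the constraint is
      violated by \<open>g (r i)\<close> by less than \<open>e / 2\<close>.\<close>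
    have close: "\<bar>(LINT x:A s|M. k x) - \<psi> s\<bar> \<le> 0 + e" if e: "e > 0" for e
    proof -
      obtain K where K: "\<And>i j. i \<ge> K \<Longrightarrow> j \<ge> K \<Longrightarrow> (LINT x|M. norm (g i x - g j x)) < e / 2"
        using Cauchy[of "e / 2"] e by auto
      obtain i where i: "i \<ge> K" "1 / Suc i < e / 2"
        using eventually_happens'[OF sequentially_bot
            eventually_conj[OF eventually_ge_at_top[of K] small[of "e / 2"]]] e by auto
      have ri: "i \<le> r j" if "i \<le> j" for j using seq_suble[OF r(1), of j] that by simp
      have "AE x in M. (\<lambda>j. norm (g (r j) x - g (r i) x)) \<longlonglongrightarrow> norm (k x - g (r i) x)"
        using kl by eventually_elim (intro tendsto_intros)
      moreover have "eventually (\<lambda>j. (LINT x|M. norm (g (r j) x - g (r i) x)) \<le> e / 2) sequentially"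
        using eventually_ge_at_top[of i]
      proof eventually_elim
        case (elim j)
        show ?case using K[of "r j" "r i"] ri[OF elim] ri[of i] i(1) by simp
      qed
      ultimately have 1: "(LINT x|M. norm (k x - g (r i) x)) \<le> e / 2"
        using fatou_le(2)[of M "\<lambda>j x. norm (g (r j) x - g (r i) x)" "\<lambda>x. norm (k x - g (r i) x)" "e / 2"] gi
        by auto
      have kA: "set_integrable M (A s) k"
        unfolding set_integrable_def using kint A[OF s] by (intro integrable_mult_indicator)
      have "\<bar>(LINT x:A s|M. k x) - (LINT x:A s|M. g (r i) x)\<bar> = \<bar>LINT x:A s|M. (k x - g (r i) x)\<bar>"
        by (simp add: set_integral_diff(2)[OF kA gAi[OF s]])
      also have "\<dots> \<le> (LINT x|M. norm (k x - g (r i) x))"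
        unfolding set_lebesgue_integral_def
      proof (rule order_trans[OF integral_abs_bound integral_mono])
        show "integrable M (\<lambda>x. \<bar>indicat_real (A s) x *\<^sub>R (k x - g (r i) x)\<bar>)"
          using kint gi A[OF s] by (intro integrable_abs integrable_mult_indicator) auto
      qed (use kint gi in \<open>auto simp: indicator_def\<close>)
      finally have "\<bar>(LINT x:A s|M. k x) - (LINT x:A s|M. g (r i) x)\<bar> \<le> e / 2" using 1 by simp
      moreover have "1 / real (Suc (r i)) \<le> 1 / Suc i"
        using seq_suble[OF r(1), of i] by (simp add: frac_le)
      ultimately show ?thesis using gA[OF s, of "r i"] i(2) by argo
    qed
    have "\<bar>(LINT x:A s|M. k x) - \<psi> s\<bar> \<le> 0" by (rule field_le_epsilon) (rule close)
    then show ?thesis by simp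
  qed
  moreover have "N k \<le> B" by (rule field_le_epsilon) (use ksq in blast)
  moreover have "0 \<le> k x" for x by (simp add: k_def)
  ultimately show ?thesis
    using ksq[OF zero_less_one] by (intro bexI[of _ k]) (auto simp: N_def)
qed

subsection \<open>Symmetric competitors as admissible sets\<close>

text \<open>Used to repeat a density: from a half to the full boundary, and from one period to two.
  At the junction \<open>a\<close> the value of \<open>f\<close> replaces \<open>g 0\<close>, a
  change at a single point.\<close>

lemma integral_glue:
  fixes f g :: "real \<Rightarrow> real"
  assumes "0 \<le> a" "0 \<le> b" "f integrable_on {0..a}" "g integrable_on {0..b}"
  defines "h \<equiv> \<lambda>t. if t \<le> a then f t else g (t - a)"
  shows "h integrable_on {0..a + b}"
    and "s \<in> {0..a} \<Longrightarrow> integral {0..s} h = integral {0..s} f"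
    and "s \<in> {0..b} \<Longrightarrow> integral {0..a + s} h = integral {0..a} f + integral {0..s} g"
proof -
  have 1: "(h has_integral integral {0..s} f) {0..s}" if "s \<in> {0..a}" for s
  proof (rule has_integral_eq)
    show "(f has_integral integral {0..s} f) {0..s}"
      using assms(3) that by (intro integrable_integral) (auto intro: integrable_on_subinterval)
    show "f x = h x" if "x \<in> {0..s}" for x using that \<open>s \<in> {0..a}\<close> by (auto simp: h_def)
  qed
  have 2: "(h has_integral integral {0..s} g) {a..a + s}" if "s \<in> {0..b}" for s
  proof (rule has_integral_spike_finite)
    have "(g has_integral integral {0..s} g) {0..s}"
      using assms(4) that by (intro integrable_integral) (auto intro: integrable_on_subinterval)
    from has_integral_shift_real_ivl[OF this, of "- a"]
    show "((\<lambda>t. g (t - a)) has_integral integral {0..s} g) {a..a + s}" by (simp add: add.commute)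
    show "finite {a}" by simp
    show "h x = g (x - a)" if "x \<in> {a..a + s} - {a}" for x using that by (auto simp: h_def)
  qed
  have 3: "(h has_integral integral {0..a} f + integral {0..s} g) {0..a + s}" if "s \<in> {0..b}" for s
    using has_integral_combine[OF _ _ 1[of a] 2[OF that]] assms(1) that by auto
  show "h integrable_on {0..a + b}" using 3[of b] assms(2) by auto
  show "s \<in> {0..a} \<Longrightarrow> integral {0..s} h = integral {0..s} f" using 1 by (rule integral_unique)
  show "s \<in> {0..b} \<Longrightarrow> integral {0..a + s} h = integral {0..a} f + integral {0..s} g"
    using 3 by (rule integral_unique)
qed

text \<open>The passage from the gauge integral, in which shifts and splittings are computed, back
  to the Lebesgue integral of the admissibility conditions; nonnegativity turns gauge integrability
  into absolute integrability.\<close>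

lemma set_integrable_lborel_nonneg:
  fixes f :: "real \<Rightarrow> real"
  assumes [measurable]: "f \<in> borel_measurable borel" and "\<And>x. 0 \<le> f x" and "f integrable_on {a..b}"
  shows "set_integrable lborel {a..b} f"
proof -
  have "f absolutely_integrable_on {a..b}"
    using assms by (intro nonnegative_absolutely_integrable_1) auto
  then show ?thesis
    unfolding set_integrable_def
    by (subst (asm) integrable_completion) auto
qed

text \<open>The analytic data of one half of a symmetric competitor. Sign and measurability of the
  density are imposed on the whole line, so that shifted and glued copies inherit them; the angle is
  tied to it only on \<open>{0..pi}\<close>.\<close>

definition turning_density :: "(real \<Rightarrow> real) \<Rightarrow> (real \<Rightarrow> real) \<Rightarrow> bool" where
  "turning_density \<kappa> \<theta> \<longleftrightarrow> \<kappa> \<in> borel_measurable borel \<and> (\<forall>x. 0 \<le> \<kappa> x) \<and>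
     \<kappa> integrable_on {0..pi} \<and> (\<lambda>x. (\<kappa> x)\<^sup>2) integrable_on {0..pi} \<and>
     (\<forall>s\<in>{0..pi}. \<theta> s = \<theta> 0 + integral {0..s} \<kappa>) \<and> \<theta> pi = \<theta> 0 + pi"

text \<open>The factor \<open>1/2\<close> of the elastic energy is absorbed by integrating over one of two equal halves.\<close>
definition sym_value :: "real \<Rightarrow> (real \<Rightarrow> real) \<Rightarrow> (real \<Rightarrow> real) \<Rightarrow> real" where
  "sym_value \<mu> \<kappa> \<theta> = integral {0..pi} (\<lambda>x. (\<kappa> x)\<^sup>2) + \<mu> * measure lebesgue (sym_body \<theta>)"

lemma half_turn_turning_density:
  assumes "turning_density \<kappa> \<theta>"
  shows "half_turn \<theta>"
proof
  have \<kappa>: "\<kappa> integrable_on {0..pi}" "\<And>x. 0 \<le> \<kappa> x" "\<And>s. s \<in> {0..pi} \<Longrightarrow> \<theta> s = \<theta> 0 + integral {0..s} \<kappa>"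
    using assms unfolding turning_density_def by blast+
  have "continuous_on {0..pi} (\<lambda>s. \<theta> 0 + integral {0..s} \<kappa>)"
    using \<kappa>(1) by (intro continuous_intros indefinite_integral_continuous_1)
  then show "continuous_on {0..pi} \<theta>"
    by (subst continuous_on_cong[OF refl \<kappa>(3)]) auto
  show "\<theta> s \<le> \<theta> t" if "0 \<le> s" "s \<le> t" "t \<le> pi" for s t
  proof -
    have "integral {0..s} \<kappa> \<le> integral {0..t} \<kappa>"
      using that \<kappa>(1,2) by (intro integral_subset_le) (auto intro: integrable_on_subinterval)
    then show ?thesis using \<kappa>(3)[of s] \<kappa>(3)[of t] that by simp
  qed
  show "\<theta> pi = \<theta> 0 + pi" using assms unfolding turning_density_def by blast
qed

lemma set_integral_continuous_eq_integral:
  fixes f :: "real \<Rightarrow> real"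
  assumes "continuous_on {a..b} f"
  shows "(LINT t:{a..b}|lborel. f t) = integral {a..b} f"
  using assms by (intro set_borel_integral_eq_integral borel_integrable_atLeastAtMost')

text \<open>Repeating the density on the second half raises the tangent angle by \<open>pi\<close>,
  so the tangent vector changes sign and the second half of the curve is the reflection of the
  first. The curve closes for this reason.\<close>

lemma symmetric_admissible:
  assumes td: "turning_density \<kappa> \<theta>"
  shows "\<exists>k. admissible_param (interior (sym_body \<theta>)) (2 * pi) k (\<theta> 0) (half_curve \<theta> 0) \<and>
      J \<mu> (interior (sym_body \<theta>)) (2 * pi) k = sym_value \<mu> \<kappa> \<theta>"
proof -
  interpret half_turn \<theta> by (rule half_turn_turning_density[OF td])
  define k where "k t = (if t \<le> pi then \<kappa> t else \<kappa> (t - pi))" for t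
  have \<kappa>: "\<kappa> \<in> borel_measurable borel" "\<And>x. 0 \<le> \<kappa> x" "\<kappa> integrable_on {0..pi}" "(\<lambda>x. (\<kappa> x)\<^sup>2) integrable_on {0..pi}"
    "\<And>s. s \<in> {0..pi} \<Longrightarrow> \<theta> s = \<theta> 0 + integral {0..s} \<kappa>"
    using td unfolding turning_density_def by blast+
  note [measurable] = \<kappa>(1)
  have km[measurable]: "k \<in> borel_measurable borel" unfolding k_def by measurable
  have knn: "0 \<le> k t" for t using \<kappa>(2) by (simp add: k_def)
  have ksq: "(\<lambda>t. (k t)\<^sup>2) = (\<lambda>t. if t \<le> pi then (\<kappa> t)\<^sup>2 else (\<kappa> (t - pi))\<^sup>2)" by (auto simp: k_def)
  have pi0: "0 \<le> pi" by simp
  note g1 = integral_glue[OF pi0 pi0 \<kappa>(3,3), folded k_def]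
  note g2 = integral_glue[OF pi0 pi0 \<kappa>(4,4), folded ksq]
  have ki: "set_integrable lborel {0..2 * pi} k"
    using g1(1) knn by (intro set_integrable_lborel_nonneg) auto
  have k2i: "set_integrable lborel {0..2 * pi} (\<lambda>t. (k t)\<^sup>2)"
    using g2(1) by (intro set_integrable_lborel_nonneg) auto
  have T: "tangent_angle (\<theta> 0) k s = \<theta> 0 + integral {0..s} k" if "s \<le> 2 * pi" for s
    unfolding tangent_angle_def
    by (subst set_borel_integral_eq_integral(2)[OF set_integrable_subset[OF ki]]) (use that in auto)
  have T1: "tangent_angle (\<theta> 0) k s = \<theta> s" if "s \<in> {0..pi}" for s
    using T[of s] g1(2)[OF that] \<kappa>(5)[OF that] that by simp
  have T2: "tangent_angle (\<theta> 0) k (pi + s) = \<theta> s + pi" if "s \<in> {0..pi}" for s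
    using T[of "pi + s"] g1(3)[OF that] \<kappa>(5)[OF that] \<kappa>(5)[of pi] turn that by simp
  have Tc: "continuous_on {0..2 * pi} (tangent_angle (\<theta> 0) k)"
  proof -
    have "continuous_on {0..2 * pi} (\<lambda>s. \<theta> 0 + integral {0..s} k)"
      using g1(1) by (intro continuous_intros indefinite_integral_continuous_1) auto
    then show ?thesis by (subst continuous_on_cong[OF refl T]) auto
  qed
  \<comment> \<open>Stated for any function that changes sign under a shift by \<open>pi\<close>,
    hence for cosine and sine alike. The second formula with \<open>s = pi\<close> is the closing
    condition.\<close>
  have trig: "(LINT t:{0..s}|lborel. f (tangent_angle (\<theta> 0) k t)) = integral {0..s} (\<lambda>u. f (\<theta> u))"
    "(LINT t:{0..pi + s}|lborel. f (tangent_angle (\<theta> 0) k t))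
       = integral {0..pi} (\<lambda>u. f (\<theta> u)) - integral {0..s} (\<lambda>u. f (\<theta> u))"
    if f: "continuous_on UNIV f" "\<And>x. f (x + pi) = - f x" and s: "s \<in> {0..pi}" for f :: "real \<Rightarrow> real" and s
  proof -
    let ?h = "\<lambda>t. if t \<le> pi then f (\<theta> t) else - f (\<theta> (t - pi))"
    have fc: "continuous_on {a..b} (\<lambda>t. f (tangent_angle (\<theta> 0) k t))" if "0 \<le> a" "b \<le> 2 * pi" for a b
      using that by (intro continuous_on_compose2[OF f(1) continuous_on_subset[OF Tc]]) auto
    have fi: "(\<lambda>u. f (\<theta> u)) integrable_on {0..pi}" "(\<lambda>u. - f (\<theta> u)) integrable_on {0..pi}"
      by (intro integrable_neg integrable_continuous_real continuous_on_compose2[OF f(1) cont]; simp)+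
    note g3 = integral_glue[OF pi0 pi0 fi]
    have h: "f (tangent_angle (\<theta> 0) k t) = ?h t" if "t \<in> {0..2*pi}" for t
      using T1[of t] T2[of "t - pi"] that f(2) by auto
    have "(LINT t:{0..s}|lborel. f (tangent_angle (\<theta> 0) k t)) = integral {0..s} ?h"
      using s fc h by (subst set_integral_continuous_eq_integral) (auto intro!: integral_cong)
    then show "(LINT t:{0..s}|lborel. f (tangent_angle (\<theta> 0) k t)) = integral {0..s} (\<lambda>u. f (\<theta> u))"
      using g3(2)[OF s] by simp
    have "(LINT t:{0..pi + s}|lborel. f (tangent_angle (\<theta> 0) k t)) = integral {0..pi + s} ?h"
      using s fc h by (subst set_integral_continuous_eq_integral) (auto intro!: integral_cong)
    then show "(LINT t:{0..pi + s}|lborel. f (tangent_angle (\<theta> 0) k t))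
       = integral {0..pi} (\<lambda>u. f (\<theta> u)) - integral {0..s} (\<lambda>u. f (\<theta> u))"
      using g3(3)[OF s] by simp
  qed
  have cs: "continuous_on UNIV (cos :: real \<Rightarrow> real)" "continuous_on UNIV (sin :: real \<Rightarrow> real)"
    by (intro continuous_intros)+
  note tc = trig[OF cs(1) cos_periodic_pi] and ts = trig[OF cs(2) sin_periodic_pi]
  have split: "integral {0..pi} (\<lambda>u. f (\<theta> u)) = integral {0..s} (\<lambda>u. f (\<theta> u)) + integral {s..pi} (\<lambda>u. f (\<theta> u))"
    if "(\<lambda>u. f (\<theta> u)) integrable_on {0..pi}" "s \<in> {0..pi}" for f :: "real \<Rightarrow> real" and s
    using Henstock_Kurzweil_Integration.integral_combine[OF _ _ that(1), of s] that(2) by simp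
  have b1: "bcurve (half_curve \<theta> 0) (\<theta> 0) k s = half_curve \<theta> s" if "s \<in> {0..pi}" for s
    using tc(1)[OF that] ts(1)[OF that] split[OF integrable(3) that] split[OF integrable(4) that]
    by (simp add: bcurve_def half_curve_def field_simps)
  have b2: "bcurve (half_curve \<theta> 0) (\<theta> 0) k (pi + s) = - half_curve \<theta> s" if "s \<in> {0..pi}" for s
    using tc(2)[OF that] ts(2)[OF that] split[OF integrable(3) that] split[OF integrable(4) that]
    by (simp add: bcurve_def half_curve_def field_simps)
  have split2: "{0..2 * pi} = {0..pi} \<union> (\<lambda>s. pi + s) ` {0..pi}" by auto
  have "frontier (interior (sym_body \<theta>)) = frontier (sym_body \<theta>)"
    using convex_closure_interior[OF convex_sym_body, of \<theta>] zero_in_interior_sym_body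
    by (auto simp: frontier_def)
  also have "\<dots> = bcurve (half_curve \<theta> 0) (\<theta> 0) k ` {0..2 * pi}"
    unfolding frontier_sym_body split2 image_Un image_image using b1 b2 by simp
  finally have fr: "frontier (interior (sym_body \<theta>)) = \<dots>" .
  have "admissible_param (interior (sym_body \<theta>)) (2 * pi) k (\<theta> 0) (half_curve \<theta> 0)"
    unfolding admissible_param_def
    using ki k2i knn T2[of pi] turn tc(2)[of pi] ts(2)[of pi] compact_sym_body[of \<theta>]
    by (auto simp: fr convex_interior convex_sym_body compact_imp_bounded)
  moreover have "J \<mu> (interior (sym_body \<theta>)) (2 * pi) k = sym_value \<mu> \<kappa> \<theta>"
  proof -
    have "(LINT t:{0..2*pi}|lborel. (k t)\<^sup>2) = 2 * integral {0..pi} (\<lambda>x. (\<kappa> x)\<^sup>2)"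
      using set_borel_integral_eq_integral(2)[OF k2i] g2(3)[of pi] by simp
    moreover have "measure lebesgue (interior (sym_body \<theta>)) = measure lebesgue (sym_body \<theta>)"
      using compact_sym_body convex_sym_body
      by (intro measure_interior negligible_convex_frontier) (auto simp: compact_imp_bounded)
    ultimately show ?thesis by (simp add: J_def elastic_energy_def area_def sym_value_def)
  qed
  ultimately show ?thesis by blast
qed

lemma centrally_symmetric_interior_sym_body: "centrally_symmetric (interior (sym_body \<theta>))"
  unfolding centrally_symmetric_def
  by (rule exI[of _ 0]) (use interior_sym_body_uminus in auto)

subsection \<open>Existence for the symmetric problem\<close>

lemma integral_restrict_lborel:
  fixes f :: "real \<Rightarrow> real"
  assumes "set_integrable lborel {0..L} f"
  shows "integrable (restrict_space lborel {0..L}) f"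
    and "integral\<^sup>L (restrict_space lborel {0..L}) f = integral {0..L} f"
    and "s \<le> L \<Longrightarrow> (LINT x:{0..s}|restrict_space lborel {0..L}. f x) = integral {0..s} f"
proof -
  show "integrable (restrict_space lborel {0..L}) f"
    using assms by (simp add: integrable_restrict_space set_integrable_def)
  show "integral\<^sup>L (restrict_space lborel {0..L}) f = integral {0..L} f"
    using set_borel_integral_eq_integral(2)[OF assms]
    by (simp add: integral_restrict_space set_lebesgue_integral_def)
  assume s: "s \<le> L"
  have "(LINT x:{0..s}|restrict_space lborel {0..L}. f x) = (LINT x:{0..s}|lborel. f x)"
    unfolding set_lebesgue_integral_def using s
    by (subst integral_restrict_space) (auto intro!: Bochner_Integration.integral_cong simp: indicator_def)
  also have "\<dots> = integral {0..s} f"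
    by (intro set_borel_integral_eq_integral set_integrable_subset[OF assms]) (use s in auto)
  finally show "(LINT x:{0..s}|restrict_space lborel {0..L}. f x) = integral {0..s} f" .
qed

text \<open>The abstract limit statement on an interval with Lebesgue measure, where the tested sets
  \<open>{0..s}\<close> prescribe the primitive of the density.\<close>

lemma density_limit:
  fixes \<psi> :: "real \<Rightarrow> real"
  assumes ex: "\<And>\<epsilon>. \<epsilon> > 0 \<Longrightarrow> \<exists>\<kappa>\<in>borel_measurable borel. (\<forall>x. 0 \<le> \<kappa> x) \<and> \<kappa> integrable_on {0..L} \<and>
      (\<lambda>x. (\<kappa> x)\<^sup>2) integrable_on {0..L} \<and> integral {0..L} (\<lambda>x. (\<kappa> x)\<^sup>2) \<le> B + \<epsilon> \<and>
      (\<forall>s\<in>{0..L}. \<bar>integral {0..s} \<kappa> - \<psi> s\<bar> \<le> \<epsilon>)"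
  shows "\<exists>\<kappa>\<in>borel_measurable borel. (\<forall>x. 0 \<le> \<kappa> x) \<and> \<kappa> integrable_on {0..L} \<and>
      (\<lambda>x. (\<kappa> x)\<^sup>2) integrable_on {0..L} \<and> integral {0..L} (\<lambda>x. (\<kappa> x)\<^sup>2) \<le> B \<and>
      (\<forall>s\<in>{0..L}. integral {0..s} \<kappa> = \<psi> s)"
proof -
  let ?M = "restrict_space lborel {0..L}"
  interpret finite_measure ?M
    by (rule finite_measureI) (simp add: emeasure_restrict_space space_restrict_space emeasure_lborel_Icc_eq)
  have "\<exists>k\<in>borel_measurable ?M. (\<forall>x. 0 \<le> k x) \<and> integrable ?M (\<lambda>x. (k x)\<^sup>2) \<and>
      (LINT x|?M. (k x)\<^sup>2) \<le> B \<and> (\<forall>s\<in>{0..L}. (LINT x:{0..s}|?M. k x) = \<psi> s)"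
  proof (rule square_integrable_limit)
    show "{0..s} \<in> sets ?M" if "s \<in> {0..L}" for s
      using that by (auto simp: sets_restrict_space_iff)
    fix \<epsilon> :: real assume "\<epsilon> > 0"
    from ex[OF this] obtain \<kappa> where \<kappa>: "\<kappa> \<in> borel_measurable borel" "\<And>x. 0 \<le> \<kappa> x" "\<kappa> integrable_on {0..L}"
      "(\<lambda>x. (\<kappa> x)\<^sup>2) integrable_on {0..L}" "integral {0..L} (\<lambda>x. (\<kappa> x)\<^sup>2) \<le> B + \<epsilon>"
      "\<And>s. s \<in> {0..L} \<Longrightarrow> \<bar>integral {0..s} \<kappa> - \<psi> s\<bar> \<le> \<epsilon>" by blast
    note [measurable] = \<kappa>(1)
    note 1 = integral_restrict_lborel[OF set_integrable_lborel_nonneg[OF \<kappa>(1,2,3)]]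
    have 2: "set_integrable lborel {0..L} (\<lambda>x. (\<kappa> x)\<^sup>2)"
      using \<kappa>(4) by (intro set_integrable_lborel_nonneg) auto
    show "\<exists>k\<in>borel_measurable ?M. (\<forall>x. 0 \<le> k x) \<and> integrable ?M (\<lambda>x. (k x)\<^sup>2) \<and>
      (LINT x|?M. (k x)\<^sup>2) \<le> B + \<epsilon> \<and> (\<forall>s\<in>{0..L}. \<bar>(LINT x:{0..s}|?M. k x) - \<psi> s\<bar> \<le> \<epsilon>)"
      using 1 integral_restrict_lborel[OF 2] \<kappa> by (intro bexI[of _ \<kappa>]) (auto intro: borel_measurable_integrable)
  qed
  then obtain k where k: "k \<in> borel_measurable ?M" "\<And>x. 0 \<le> k x" "integrable ?M (\<lambda>x. (k x)\<^sup>2)"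
      "(LINT x|?M. (k x)\<^sup>2) \<le> B" "\<And>s. s \<in> {0..L} \<Longrightarrow> (LINT x:{0..s}|?M. k x) = \<psi> s" by blast
  \<comment> \<open>Extension by zero makes the density Borel on the whole line; so far it is
    measurable only on the restricted space.\<close>
  define \<kappa> where "\<kappa> x = indicat_real {0..L} x * k x" for x
  have [measurable]: "\<kappa> \<in> borel_measurable borel"
    using k(1) unfolding \<kappa>_def by (subst (asm) borel_measurable_restrict_space_iff) auto
  have "set_integrable lborel {0..L} k"
    using integrable_of_square[OF k(1,3)] by (simp add: integrable_restrict_space set_integrable_def)
  then have s1: "set_integrable lborel {0..L} \<kappa>"
    unfolding set_integrable_def
    by (rule Bochner_Integration.integrable_cong[THEN iffD1, rotated 2]) (auto simp: \<kappa>_def indicator_def)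
  have "set_integrable lborel {0..L} (\<lambda>x. (k x)\<^sup>2)"
    using k(3) by (simp add: integrable_restrict_space set_integrable_def)
  then have s2: "set_integrable lborel {0..L} (\<lambda>x. (\<kappa> x)\<^sup>2)"
    unfolding set_integrable_def
    by (rule Bochner_Integration.integrable_cong[THEN iffD1, rotated 2]) (auto simp: \<kappa>_def indicator_def)
  have eqM: "integral\<^sup>L ?M (\<lambda>x. (\<kappa> x)\<^sup>2) = (LINT x|?M. (k x)\<^sup>2)"
    by (intro Bochner_Integration.integral_cong) (auto simp: \<kappa>_def space_restrict_space)
  have eqA: "(LINT x:{0..s}|?M. \<kappa> x) = (LINT x:{0..s}|?M. k x)" for s
    unfolding set_lebesgue_integral_def
    by (intro Bochner_Integration.integral_cong) (auto simp: \<kappa>_def space_restrict_space)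
  show ?thesis
  proof (intro bexI[of _ \<kappa>] conjI allI ballI)
    show "0 \<le> \<kappa> x" for x using k(2) by (simp add: \<kappa>_def)
    show "\<kappa> integrable_on {0..L}" "(\<lambda>x. (\<kappa> x)\<^sup>2) integrable_on {0..L}"
      using s1 s2 by (auto intro: set_borel_integral_eq_integral)
    show "integral {0..L} (\<lambda>x. (\<kappa> x)\<^sup>2) \<le> B"
      using k(4) integral_restrict_lborel(2)[OF s2] eqM by simp
    show "integral {0..s} \<kappa> = \<psi> s" if "s \<in> {0..L}" for s
      using k(5)[OF that] integral_restrict_lborel(3)[OF s1, of s] eqA[of s] that by simp
  qed measurable
qed

text \<open>The half width is bounded below, so a small uniform change of the angle lowers it at
  most by a factor \<open>1 - c\<close>. The body of \<open>\<theta>\<close> shrunk by this factor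
  then fits into the body of \<open>\<theta>'\<close>, and area scales by the square of the
  factor.\<close>

lemma measure_sym_body_lower_semicontinuous:
  assumes "half_turn \<theta>" "\<epsilon> > 0"
  shows "\<exists>\<eta>>0. \<forall>\<theta>'. half_turn \<theta>' \<and> (\<forall>u\<in>{0..pi}. \<bar>\<theta>' u - \<theta> u\<bar> \<le> \<eta>) \<longrightarrow>
     measure lebesgue (sym_body \<theta>) - \<epsilon> \<le> measure lebesgue (sym_body \<theta>')"
proof -
  interpret half_turn \<theta> by fact
  obtain \<delta> where \<delta>: "\<delta> > 0" "\<And>\<phi>. \<delta> \<le> half_width \<theta> \<phi>"
    using half_width_lower_bound by blast
  define m where "m = measure lebesgue (sym_body \<theta>)"
  have m: "0 \<le> m" by (simp add: m_def)
  \<comment> \<open>Chosen so that the loss \<open>2 * c * m\<close> of area stays below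
    \<open>\<epsilon>\<close>; the added 1 covers \<open>m = 0\<close>.\<close>
  define c where "c = min 1 (\<epsilon> / (2 * (m + 1)))"
  have c: "0 < c" "c \<le> 1" using assms(2) m by (auto simp: c_def add_nonneg_pos)
  have "c * (2 * (m + 1)) \<le> \<epsilon>"
  proof -
    have "c \<le> \<epsilon> / (2 * (m + 1))" by (simp add: c_def)
    then show ?thesis using m by (simp add: pos_le_divide_eq)
  qed
  then have cm: "2 * c * m \<le> \<epsilon>" using c by (simp add: algebra_simps)
  \<comment> \<open>Makes the loss \<open>pi / 2 * \<eta>\<close> of half width equal to
    \<open>\<delta> * c\<close>, which is at most the fraction \<open>c\<close> of the half
    width.\<close>
  define \<eta> where "\<eta> = 2 * \<delta> * c / pi"
  have "\<eta> > 0" using \<delta> c by (simp add: \<eta>_def)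
  moreover have "m - \<epsilon> \<le> measure lebesgue (sym_body \<theta>')"
    if \<theta>': "half_turn \<theta>'" "\<forall>u\<in>{0..pi}. \<bar>\<theta>' u - \<theta> u\<bar> \<le> \<eta>" for \<theta>'
  proof -
    have w: "(1 - c) * half_width \<theta> \<phi> \<le> half_width \<theta>' \<phi>" for \<phi>
    proof -
      have "half_width \<theta> \<phi> \<le> half_width \<theta>' \<phi> + pi / 2 * \<eta>"
        by (rule half_width_le_add[OF cont half_turn.cont[OF \<theta>'(1)]])
          (use \<theta>'(2) in \<open>auto simp: abs_minus_commute\<close>)
      moreover have "pi / 2 * \<eta> = \<delta> * c" by (simp add: \<eta>_def)
      moreover have "\<delta> * c \<le> half_width \<theta> \<phi> * c" using \<delta>(2) c by (intro mult_right_mono) auto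
      ultimately show ?thesis by (simp add: algebra_simps)
    qed
    have sub: "(\<lambda>x. (1 - c) *\<^sub>R x + 0) ` sym_body \<theta> \<subseteq> sym_body \<theta>'"
    proof (clarsimp simp only: sym_body_def normal_coord_simps add_0_right image_subset_iff mem_Collect_eq)
      fix x \<phi> assume x: "\<forall>\<phi>. \<bar>normal_coord \<phi> x\<bar> \<le> half_width \<theta> \<phi>"
      have "\<bar>(1 - c) * normal_coord \<phi> x\<bar> = (1 - c) * \<bar>normal_coord \<phi> x\<bar>" using c by (simp add: abs_mult)
      also have "\<dots> \<le> (1 - c) * half_width \<theta> \<phi>" using x c by (intro mult_left_mono) auto
      finally show "\<bar>(1 - c) * normal_coord \<phi> x\<bar> \<le> half_width \<theta>' \<phi>" using w[of \<phi>] by linarith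
    qed
    have "compact ((\<lambda>x. (1 - c) *\<^sub>R x + 0) ` sym_body \<theta>)"
      by (intro compact_continuous_image continuous_intros compact_sym_body)
    then have "measure lebesgue ((\<lambda>x. (1 - c) *\<^sub>R x + 0) ` sym_body \<theta>) \<le> measure lebesgue (sym_body \<theta>')"
      by (intro measure_mono_fmeasurable sub) (auto intro: lmeasurable_compact fmeasurableD compact_sym_body)
    then have "(1 - c)\<^sup>2 * m \<le> measure lebesgue (sym_body \<theta>')"
      by (subst (asm) measure_lebesgue_affine) (simp add: m_def power2_eq_square)
    moreover have "m - 2 * c * m \<le> (1 - c)\<^sup>2 * m"
      using m c by (simp add: power2_eq_square algebra_simps)
    ultimately show ?thesis using cm by linarith
  qed
  ultimately show ?thesis unfolding m_def by blast
qed

lemma turning_density_shift: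
  assumes "turning_density \<kappa> \<theta>"
  shows "turning_density \<kappa> (\<lambda>u. \<theta> u + c)"
proof -
  have "\<forall>s\<in>{0..pi}. \<theta> s + c = \<theta> 0 + c + integral {0..s} \<kappa>" "\<theta> pi + c = \<theta> 0 + c + pi"
    using assms unfolding turning_density_def by (metis add.assoc add.commute)+
  then show ?thesis using assms unfolding turning_density_def by blast
qed

text \<open>The pointwise bound \<open>\<kappa> \<le> l * \<kappa>\<^sup>2 + 1 / l\<close>,
  integrated, is a Cauchy-Schwarz estimate with a free parameter. It gives equicontinuity of the
  angles under a common energy bound.\<close>

lemma turning_density_modulus:
  assumes "turning_density \<kappa> \<theta>" "integral {0..pi} (\<lambda>x. (\<kappa> x)\<^sup>2) \<le> B" "l > 0" "0 \<le> s" "s \<le> t" "t \<le> pi"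
  shows "\<theta> t - \<theta> s \<le> l * B + (t - s) / l"
proof -
  have \<kappa>: "\<kappa> integrable_on {0..pi}" "(\<lambda>x. (\<kappa> x)\<^sup>2) integrable_on {0..pi}" "\<And>x. 0 \<le> \<kappa> x"
     "\<And>s. s \<in> {0..pi} \<Longrightarrow> \<theta> s = \<theta> 0 + integral {0..s} \<kappa>"
    using assms(1) unfolding turning_density_def by blast+
  have st: "\<kappa> integrable_on {s..t}" "(\<lambda>x. (\<kappa> x)\<^sup>2) integrable_on {s..t}"
    using assms \<kappa>(1,2) by (auto intro: integrable_on_subinterval)
  have "integral {0..t} \<kappa> = integral {0..s} \<kappa> + integral {s..t} \<kappa>"
    using assms \<kappa>(1)
    by (intro Henstock_Kurzweil_Integration.integral_combine[symmetric]) (auto intro: integrable_on_subinterval)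
  then have "\<theta> t - \<theta> s = integral {s..t} \<kappa>" using \<kappa>(4)[of s] \<kappa>(4)[of t] assms by simp
  also have "\<dots> \<le> integral {s..t} (\<lambda>x. l * (\<kappa> x)\<^sup>2 + 1 / l)"
  proof (rule integral_le)
    show "\<kappa> x \<le> l * (\<kappa> x)\<^sup>2 + 1 / l" for x
    proof -
      have "2 * \<kappa> x \<le> l * (\<kappa> x)\<^sup>2 + 1 / l"
        using zero_le_power2[of "l * \<kappa> x - 1"] assms(3)
        by (simp add: power2_diff power_mult_distrib field_simps power2_eq_square)
      then show ?thesis using \<kappa>(3)[of x] by argo
    qed
    show "(\<lambda>x. l * (\<kappa> x)\<^sup>2 + 1 / l) integrable_on {s..t}"
      using st(2) by (intro integrable_add integrable_on_mult_right) auto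
  qed (rule st)
  also have "\<dots> = l * integral {s..t} (\<lambda>x. (\<kappa> x)\<^sup>2) + (t - s) / l"
    using st(2) assms by (subst integral_add) (auto intro: integrable_on_mult_right)
  also have "integral {s..t} (\<lambda>x. (\<kappa> x)\<^sup>2) \<le> integral {0..pi} (\<lambda>x. (\<kappa> x)\<^sup>2)"
    using assms \<kappa>(2) st(2) by (intro integral_subset_le) auto
  finally show ?thesis using assms(2,3) by (simp add: mult_left_mono) (meson add_right_mono mult_left_mono less_imp_le order_trans)
qed

lemma sym_value_minimizer_exists:
  assumes "\<mu> \<ge> 0"
  shows "\<exists>\<kappa> \<theta>. turning_density \<kappa> \<theta> \<and>
     (\<forall>\<kappa>' \<theta>'. turning_density \<kappa>' \<theta>' \<longrightarrow> sym_value \<mu> \<kappa> \<theta> \<le> sym_value \<mu> \<kappa>' \<theta>')"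
proof -
  define V where "V = {sym_value \<mu> \<kappa> \<theta> | \<kappa> \<theta>. turning_density \<kappa> \<theta>}"
  define v where "v = Inf V"
  \<comment> \<open>Claimed for arbitrary functions: where the square is not integrable, its
    integral has the default value 0.\<close>
  have sv_nonneg: "0 \<le> sym_value \<mu> \<kappa> \<theta>" for \<kappa> \<theta>
    unfolding sym_value_def
    using assms
    by (cases "(\<lambda>x. (\<kappa> x)\<^sup>2) integrable_on {0..pi}")
      (auto intro!: add_nonneg_nonneg Henstock_Kurzweil_Integration.integral_nonneg simp: not_integrable_integral)
  have "turning_density (\<lambda>_. 1) (\<lambda>s. s)"
    using integrable_const_ivl[of "1 :: real" 0 pi] by (simp add: turning_density_def)
  then have "V \<noteq> {}" by (auto simp: V_def)
  have bdd: "bdd_below V" using sv_nonneg by (auto simp: V_def intro!: bdd_belowI[of _ 0])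
  have v_le: "v \<le> sym_value \<mu> \<kappa> \<theta>" if "turning_density \<kappa> \<theta>" for \<kappa> \<theta>
    unfolding v_def using that by (intro cInf_lower bdd) (auto simp: V_def)
  have "\<exists>\<kappa> \<theta>. turning_density \<kappa> \<theta> \<and> \<theta> 0 \<in> {0..2 * pi} \<and> sym_value \<mu> \<kappa> \<theta> < v + 1 / Suc n" for n
  proof -
    have "Inf V < v + 1 / Suc n" by (simp add: v_def)
    from cInf_lessD[OF \<open>V \<noteq> {}\<close> this] obtain \<kappa> \<theta> where *: "turning_density \<kappa> \<theta>" "sym_value \<mu> \<kappa> \<theta> < v + 1 / Suc n"
      unfolding V_def by blast
    \<comment> \<open>Full turns do not change the body, so the starting angle can be brought into
      one period. Otherwise the angles of a minimizing sequence could be unbounded.\<close>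
    define j where "j = - \<lfloor>\<theta> 0 / (2 * pi)\<rfloor>"
    have "of_int (- j) \<le> \<theta> 0 / (2*pi)" "\<theta> 0 / (2*pi) < of_int (- j) + 1" unfolding j_def by auto
    then have "\<theta> 0 + of_int j * (2 * pi) \<in> {0..2*pi}" by (auto simp: field_simps)
    moreover have "sym_value \<mu> \<kappa> (\<lambda>u. \<theta> u + of_int j * (2 * pi)) = sym_value \<mu> \<kappa> \<theta>"
      by (simp only: sym_value_def sym_body_shift)
    ultimately show ?thesis
      using * turning_density_shift[OF *(1), of "of_int j * (2 * pi)"]
      by (intro exI[of _ \<kappa>] exI[of _ "\<lambda>u. \<theta> u + of_int j * (2 * pi)"]) auto
  qed
  then obtain \<kappa> \<theta> where seq: "\<And>n. turning_density (\<kappa> n) (\<theta> n)" "\<And>n. \<theta> n 0 \<in> {0..2 * pi}"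
    "\<And>n. sym_value \<mu> (\<kappa> n) (\<theta> n) < v + 1 / Suc n" by metis
  have ht: "half_turn (\<theta> n)" for n by (rule half_turn_turning_density[OF seq(1)])
  define B where "B = v + 1"
  have E_B: "integral {0..pi} (\<lambda>x. (\<kappa> n x)\<^sup>2) \<le> B" for n
  proof -
    have "integral {0..pi} (\<lambda>x. (\<kappa> n x)\<^sup>2) \<le> sym_value \<mu> (\<kappa> n) (\<theta> n)"
      using assms by (simp add: sym_value_def)
    moreover have "1 / real (Suc n) \<le> 1" by simp
    ultimately show ?thesis using seq(3)[of n] unfolding B_def by argo
  qed
  have "0 \<le> B"
    using sv_nonneg[of "\<kappa> 0" "\<theta> 0"] seq(3)[of 0] by (simp add: B_def)
  obtain g r where g: "continuous_on {0..pi} g" "strict_mono (r :: nat \<Rightarrow> nat)"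
    "\<And>e. 0 < e \<Longrightarrow> \<exists>N. \<forall>n x. n \<ge> N \<and> x \<in> {0..pi} \<longrightarrow> norm (\<theta> (r n) x - g x) < e"
  \<comment> \<open>The bound is \<open>2 * pi\<close> for the starting angle plus \<open>pi\<close>
    for the turning.\<close>
  proof (rule Arzela_Ascoli[of "{0..pi}" \<theta> "3 * pi"])
    show "norm (\<theta> n x) \<le> 3 * pi" if "x \<in> {0..pi}" for n x
      using seq(2)[of n] half_turn.mono[OF ht, of 0 x n] half_turn.mono[OF ht, of x pi n] half_turn.turn[OF ht, of n] that
      by auto
    fix x e :: real assume x: "x \<in> {0..pi}" and e: "0 < e"
    \<comment> \<open>With this \<open>l\<close> the energy term of the modulus is below
      \<open>e / 2\<close>, and arc lengths below \<open>l * e / 2\<close> make the other term as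
      small.\<close>
    define l where "l = e / 2 / (B + 1)"
    have l: "l > 0" using e \<open>0 \<le> B\<close> by (simp add: l_def)
    have "l * (B + 1) = e / 2" unfolding l_def using \<open>0 \<le> B\<close> by (intro nonzero_eq_divide_eq[THEN iffD1]) auto
    then have lB: "l * B < e / 2" using l by (simp add: algebra_simps)
    have *: "\<theta> n t - \<theta> n s < e" "0 \<le> \<theta> n t - \<theta> n s"
      if "0 \<le> s" "s \<le> t" "t \<le> pi" "t - s < l * e / 2" for n s t
    proof -
      have "(t - s) / l < e / 2" using that(4) l by (simp add: field_simps)
      then show "\<theta> n t - \<theta> n s < e"
        using turning_density_modulus[OF seq(1) E_B l that(1-3), of n] lB by linarith
      show "0 \<le> \<theta> n t - \<theta> n s" using half_turn.mono[OF ht that(1-3), of n] by simp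
    qed
    have "norm (\<theta> n x - \<theta> n y) < e" if "y \<in> {0..pi}" "norm (x - y) < l * e / 2" for n y
      using *[of x y n] *[of y x n] that x by (cases "x \<le> y") auto
    then show "\<exists>d>0. \<forall>n y. y \<in> {0..pi} \<and> norm (x - y) < d \<longrightarrow> norm (\<theta> n x - \<theta> n y) < e"
      using l e by (intro exI[of _ "l * e / 2"]) auto
  qed auto
  have lim: "(\<lambda>n. \<theta> (r n) x) \<longlonglongrightarrow> g x" if "x \<in> {0..pi}" for x
    unfolding LIMSEQ_iff using g(3) that by meson
  have hg: "half_turn g"
  proof
    show "g s \<le> g t" if "0 \<le> s" "s \<le> t" "t \<le> pi" for s t
      by (rule LIMSEQ_le[OF lim lim]) (use that half_turn.mono[OF ht] in auto)
    have "(\<lambda>n. \<theta> (r n) 0 + pi) \<longlonglongrightarrow> g 0 + pi" by (intro tendsto_intros lim) auto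
    then have "(\<lambda>n. \<theta> (r n) pi) \<longlonglongrightarrow> g 0 + pi" by (simp add: half_turn.turn[OF ht])
    then show "g pi = g 0 + pi" using lim[of pi] LIMSEQ_unique by auto
  qed (rule g(1))
  define m where "m = measure lebesgue (sym_body g)"
  \<comment> \<open>The uniform limit \<open>g\<close> needs a density of its own whose energy
    leaves room for the area term. The densities of late terms are approximate solutions with energy
    bound \<open>v - \<mu> * m\<close>, by lower semicontinuity of the area.\<close>
  have "\<exists>k\<in>borel_measurable borel. (\<forall>x. 0 \<le> k x) \<and> k integrable_on {0..pi} \<and>
      (\<lambda>x. (k x)\<^sup>2) integrable_on {0..pi} \<and> integral {0..pi} (\<lambda>x. (k x)\<^sup>2) \<le> v - \<mu> * m \<and>
      (\<forall>s\<in>{0..pi}. integral {0..s} k = g s - g 0)"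
  proof (rule density_limit)
    fix \<epsilon> :: real assume \<epsilon>: "\<epsilon> > 0"
    \<comment> \<open>The area tolerance is scaled so that its weighted contribution is at most
      \<open>\<epsilon> / 2\<close>; the added 1 covers \<open>\<mu> = 0\<close>.\<close>
    define \<epsilon>' where "\<epsilon>' = \<epsilon> / 2 / (\<mu> + 1)"
    have \<epsilon>': "\<epsilon>' > 0" using \<epsilon> assms by (simp add: \<epsilon>'_def)
    have "\<epsilon>' * (\<mu> + 1) = \<epsilon> / 2" unfolding \<epsilon>'_def using assms by (intro nonzero_eq_divide_eq[THEN iffD1]) auto
    then have mu: "\<mu> * \<epsilon>' \<le> \<epsilon> / 2" using \<epsilon>' by (simp add: algebra_simps)
    obtain \<eta> where \<eta>: "\<eta> > 0" "\<And>\<theta>'. half_turn \<theta>' \<Longrightarrow> (\<forall>u\<in>{0..pi}. \<bar>\<theta>' u - g u\<bar> \<le> \<eta>) \<Longrightarrow>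
        m - \<epsilon>' \<le> measure lebesgue (sym_body \<theta>')"
      using measure_sym_body_lower_semicontinuous[OF hg \<epsilon>'] unfolding m_def by blast
    obtain N where N: "\<And>n x. n \<ge> N \<Longrightarrow> x \<in> {0..pi} \<Longrightarrow> \<bar>\<theta> (r n) x - g x\<bar> < min \<eta> (\<epsilon> / 2)"
      using g(3)[of "min \<eta> (\<epsilon> / 2)"] \<eta>(1) \<epsilon> by auto
    obtain N' where N': "1 / real (Suc N') < \<epsilon> / 2" using \<epsilon> nat_approx_posE[of "\<epsilon> / 2"] by auto
    define n where "n = r (max N N')"
    have n1: "\<bar>\<theta> n x - g x\<bar> < \<eta>" "\<bar>\<theta> n x - g x\<bar> < \<epsilon> / 2" if "x \<in> {0..pi}" for x
      using N[OF _ that, of "max N N'"] by (auto simp: n_def)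
    have "N' \<le> n" unfolding n_def using seq_suble[OF g(2), of "max N N'"] by simp
    then have "1 / real (Suc n) \<le> 1 / real (Suc N')" by (simp add: frac_le)
    with N' seq(3)[of n] have val: "sym_value \<mu> (\<kappa> n) (\<theta> n) < v + \<epsilon> / 2" by argo
    have "m - \<epsilon>' \<le> measure lebesgue (sym_body (\<theta> n))"
      using n1(1) by (intro \<eta>(2) ht) (auto intro: less_imp_le)
    then have "\<mu> * (m - \<epsilon>') \<le> \<mu> * measure lebesgue (sym_body (\<theta> n))"
      using assms by (rule mult_left_mono)
    then have en: "integral {0..pi} (\<lambda>x. (\<kappa> n x)\<^sup>2) \<le> v - \<mu> * m + \<epsilon>"
      using val mu unfolding sym_value_def by (simp add: algebra_simps)
    have td: "\<kappa> n \<in> borel_measurable borel" "\<forall>x. 0 \<le> \<kappa> n x" "\<kappa> n integrable_on {0..pi}"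
       "(\<lambda>x. (\<kappa> n x)\<^sup>2) integrable_on {0..pi}" "\<And>s. s \<in> {0..pi} \<Longrightarrow> \<theta> n s = \<theta> n 0 + integral {0..s} (\<kappa> n)"
      using seq(1)[of n] unfolding turning_density_def by blast+
    have "\<bar>\<theta> n 0 - g 0\<bar> < \<epsilon> / 2" using n1(2)[of 0] by simp
    then have "\<bar>integral {0..s} (\<kappa> n) - (g s - g 0)\<bar> \<le> \<epsilon>" if "s \<in> {0..pi}" for s
      using td(5)[OF that] n1(2)[OF that] by linarith
    then show "\<exists>k\<in>borel_measurable borel. (\<forall>x. 0 \<le> k x) \<and> k integrable_on {0..pi} \<and>
      (\<lambda>x. (k x)\<^sup>2) integrable_on {0..pi} \<and> integral {0..pi} (\<lambda>x. (k x)\<^sup>2) \<le> v - \<mu> * m + \<epsilon> \<and>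
      (\<forall>s\<in>{0..pi}. \<bar>integral {0..s} k - (g s - g 0)\<bar> \<le> \<epsilon>)"
      using td(1-4) en by (intro bexI[of _ "\<kappa> n"]) auto
  qed
  then obtain k where k: "k \<in> borel_measurable borel" "\<forall>x. 0 \<le> k x" "k integrable_on {0..pi}"
      "(\<lambda>x. (k x)\<^sup>2) integrable_on {0..pi}" "integral {0..pi} (\<lambda>x. (k x)\<^sup>2) \<le> v - \<mu> * m"
      "\<And>s. s \<in> {0..pi} \<Longrightarrow> integral {0..s} k = g s - g 0" by blast
  have "turning_density k g"
    unfolding turning_density_def using k half_turn.turn[OF hg] by auto
  moreover have "sym_value \<mu> k g \<le> v" using k(5) by (simp add: sym_value_def m_def)
  ultimately show ?thesis using v_le by (meson order_trans)
qed

subsection \<open>Symmetrization of an arbitrary competitor\<close>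

text \<open>Both half curves share their chord but traverse it in opposite senses, so their hulls
  lie on opposite sides of its line and overlap in a null set. After translation by \<open>c\<close>
  both lie in \<open>K\<close>, and each symmetric body has at most twice the area of its
  hull.\<close>

lemma measure_two_halves_le:
  assumes "half_turn \<theta>1" "half_turn \<theta>2" and opp: "half_curve \<theta>2 0 = - half_curve \<theta>1 0"
    and K: "convex K" "compact K"
    and sub: "\<And>t. t \<in> {0..pi} \<Longrightarrow> c + half_curve \<theta>1 t \<in> K" "\<And>t. t \<in> {0..pi} \<Longrightarrow> c + half_curve \<theta>2 t \<in> K"
  shows "measure lebesgue (sym_body \<theta>1) + measure lebesgue (sym_body \<theta>2) \<le> 2 * measure lebesgue K"
proof -
  interpret h1: half_turn \<theta>1 by fact
  interpret h2: half_turn \<theta>2 by fact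
  let ?H1 = "h1.half_hull" and ?H2 = "h2.half_hull" and ?a = "half_curve \<theta>1 0"
  have lm: "?H1 \<in> lmeasurable" "?H2 \<in> lmeasurable"
    using h1.compact_half_hull h2.compact_half_hull by (auto intro: lmeasurable_compact)
  have "?H1 \<inter> ?H2 \<subseteq> {x. (- snd ?a, fst ?a) \<bullet> x = 0}"
  proof
    fix x assume x: "x \<in> ?H1 \<inter> ?H2"
    then have "0 \<le> cross ?a x" "0 \<le> cross (- ?a) x"
      using h1.cross_half_hull_nonneg h2.cross_half_hull_nonneg opp by (metis IntD1, metis IntD2)
    then have "cross ?a x = 0" by (simp only: cross_simps)
    then show "x \<in> {x. (- snd ?a, fst ?a) \<bullet> x = 0}"
      by (cases x) (simp add: cross_def inner_prod_def)
  qed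
  moreover have "negligible {x. (- snd ?a, fst ?a) \<bullet> x = 0}"
    using h1.half_curve_0_nonzero by (intro negligible_hyperplane) (auto simp: prod_eq_iff)
  ultimately have "negligible (?H1 \<inter> ?H2)" by (rule negligible_subset[rotated])
  then have "measure lebesgue (?H1 \<union> ?H2) = measure lebesgue ?H1 + measure lebesgue ?H2"
    using measure_Un3_negligible[OF lm, of "{}"] by simp
  moreover have "measure lebesgue ((+) c ` (?H1 \<union> ?H2)) \<le> measure lebesgue K"
  proof (rule measure_mono_fmeasurable)
    have "?H1 \<subseteq> (+) (- c) ` K" "?H2 \<subseteq> (+) (- c) ` K"
      using sub by (intro hull_minimal convex_translation K(1); force simp: image_iff)+
    then show "(+) c ` (?H1 \<union> ?H2) \<subseteq> K" by fastforce
    show "(+) c ` (?H1 \<union> ?H2) \<in> sets lebesgue"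
      using h1.compact_half_hull h2.compact_half_hull
      by (intro fmeasurableD lmeasurable_compact compact_translation compact_Un)
    show "K \<in> lmeasurable" using K(2) by (rule lmeasurable_compact)
  qed
  ultimately have "measure lebesgue ?H1 + measure lebesgue ?H2 \<le> measure lebesgue K"
    by (simp only: measure_translation)
  then show ?thesis using h1.measure_sym_body_le h2.measure_sym_body_le by linarith
qed

lemma sym_value_le_J:
  assumes "\<mu> \<ge> 0" and adm: "admissible_param \<Omega> (2 * pi) k \<theta>0 z0"
  shows "\<exists>\<kappa> \<theta>. turning_density \<kappa> \<theta> \<and> sym_value \<mu> \<kappa> \<theta> \<le> J \<mu> \<Omega> (2 * pi) k"
proof -
  have \<Omega>: "bounded \<Omega>" "convex \<Omega>" and [measurable]: "k \<in> borel_measurable borel"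
    and ki: "set_integrable lborel {0..2 * pi} k" "set_integrable lborel {0..2 * pi} (\<lambda>s. (k s)\<^sup>2)"
    and knn: "AE s in lborel. s \<in> {0..2 * pi} \<longrightarrow> k s \<ge> 0"
    and turn: "tangent_angle \<theta>0 k (2 * pi) = \<theta>0 + 2 * pi"
    and closed: "(LINT s:{0..2 * pi}|lborel. cos (tangent_angle \<theta>0 k s)) = 0"
        "(LINT s:{0..2 * pi}|lborel. sin (tangent_angle \<theta>0 k s)) = 0"
    and fr: "frontier \<Omega> = bcurve z0 \<theta>0 k ` {0..2 * pi}"
    using adm unfolding admissible_param_def by auto
  \<comment> \<open>The curvature is nonnegative only almost everywhere; its positive part agrees
    with it up to a null set and is nonnegative everywhere, as \<open>turning_density\<close>
    demands.\<close>
  define p where "p t = max 0 (k t)" for t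
  have [measurable]: "p \<in> borel_measurable borel" unfolding p_def by measurable
  have AE_p: "AE s in lborel. s \<in> {0..2 * pi} \<longrightarrow> k s = p s"
    using knn by eventually_elim (auto simp: p_def)
  have p1: "set_integrable lborel {0..2 * pi} p"
    by (rule set_integrable_cong_AE[THEN iffD1, OF _ _ _ _ ki(1)]) (use AE_p in auto)
  have p2: "set_integrable lborel {0..2 * pi} (\<lambda>s. (p s)\<^sup>2)"
    by (rule set_integrable_cong_AE[THEN iffD1, OF _ _ _ _ ki(2)]) (use AE_p in auto)
  have pk: "(LINT t:{0..s}|lborel. k t) = integral {0..s} p" if "s \<le> 2 * pi" for s
  proof -
    have "(LINT t:{0..s}|lborel. k t) = (LINT t:{0..s}|lborel. p t)"
      using that by (intro set_lebesgue_integral_cong_AE) (auto intro: eventually_mono[OF AE_p])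
    also have "\<dots> = integral {0..s} p"
      by (intro set_borel_integral_eq_integral set_integrable_subset[OF p1]) (use that in auto)
    finally show ?thesis .
  qed
  have pk2: "(LINT t:{0..2 * pi}|lborel. (k t)\<^sup>2) = integral {0..2 * pi} (\<lambda>t. (p t)\<^sup>2)"
  proof -
    have "(LINT t:{0..2 * pi}|lborel. (k t)\<^sup>2) = (LINT t:{0..2 * pi}|lborel. (p t)\<^sup>2)"
      by (intro set_lebesgue_integral_cong_AE) (auto intro: eventually_mono[OF AE_p])
    then show ?thesis using set_borel_integral_eq_integral(2)[OF p2] by simp
  qed
  have pi2: "0 \<le> 2 * pi" by simp
  \<comment> \<open>A second period of the density, so that the arcs of length \<open>pi\<close>
    starting at \<open>s0\<close> and at \<open>s0 + pi\<close> are intervals without wrapping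
    around.\<close>
  define q where "q t = (if t \<le> 2 * pi then p t else p (t - 2 * pi))" for t
  have [measurable]: "q \<in> borel_measurable borel" unfolding q_def by measurable
  have qnn: "0 \<le> q t" for t by (simp add: q_def p_def)
  have qsq: "(\<lambda>t. (q t)\<^sup>2) = (\<lambda>t. if t \<le> 2 * pi then (p t)\<^sup>2 else (p (t - 2 * pi))\<^sup>2)" by (auto simp: q_def)
  have pint: "p integrable_on {0..2 * pi}" "(\<lambda>t. (p t)\<^sup>2) integrable_on {0..2 * pi}"
    using p1 p2 by (auto intro: set_borel_integral_eq_integral)
  note g1 = integral_glue[OF pi2 pi2 pint(1,1), folded q_def]
  note g2 = integral_glue[OF pi2 pi2 pint(2,2), folded qsq]
  have q1: "q integrable_on {a..b}" if "0 \<le> a" "b \<le> 4 * pi" for a b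
    using g1(1) that by (auto intro: integrable_on_subinterval)
  have q2: "(\<lambda>t. (q t)\<^sup>2) integrable_on {a..b}" if "0 \<le> a" "b \<le> 4 * pi" for a b
    using g2(1) that by (auto intro: integrable_on_subinterval)
  define \<Theta> where "\<Theta> s = \<theta>0 + integral {0..s} q" for s
  have \<Theta>_tangent: "\<Theta> s = tangent_angle \<theta>0 k s" if "s \<in> {0..2 * pi}" for s
    using g1(2)[OF that] pk[of s] that by (simp add: \<Theta>_def tangent_angle_def)
  have \<Theta>_per: "\<Theta> (2 * pi + s) = \<Theta> s + 2 * pi" if "s \<in> {0..2 * pi}" for s
    using g1(3)[OF that] g1(2)[OF that] pk[of "2 * pi"] turn by (simp add: \<Theta>_def tangent_angle_def)
  have \<Theta>_cont: "continuous_on {0..4 * pi} \<Theta>"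
    unfolding \<Theta>_def by (intro continuous_intros indefinite_integral_continuous_1 q1) auto
  have \<Theta>_int: "(\<lambda>u. f (\<Theta> u)) integrable_on {a..b}" if "continuous_on UNIV f" "0 \<le> a" "b \<le> 4 * pi" for f :: "real \<Rightarrow> real" and a b
    using that by (intro integrable_continuous_real continuous_on_compose2[OF that(1)] continuous_on_subset[OF \<Theta>_cont]) auto
  have cs: "continuous_on UNIV (cos :: real \<Rightarrow> real)" "continuous_on UNIV (sin :: real \<Rightarrow> real)"
    by (intro continuous_intros)+
  define \<Gamma> where "\<Gamma> s = z0 + (integral {0..s} (\<lambda>u. cos (\<Theta> u)), integral {0..s} (\<lambda>u. sin (\<Theta> u)))" for s
  have trig: "(LINT t:{0..s}|lborel. f (tangent_angle \<theta>0 k t)) = integral {0..s} (\<lambda>u. f (\<Theta> u))"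
    if "continuous_on UNIV f" "s \<in> {0..2 * pi}" for f :: "real \<Rightarrow> real" and s
  proof -
    have eq: "f (\<Theta> t) = f (tangent_angle \<theta>0 k t)" if "t \<in> {0..s}" for t
      using \<Theta>_tangent[of t] that \<open>s \<in> {0..2 * pi}\<close> by simp
    have "continuous_on {0..s} (\<lambda>t. f (\<Theta> t))"
      using that by (intro continuous_on_compose2[OF that(1)] continuous_on_subset[OF \<Theta>_cont]) auto
    then have "continuous_on {0..s} (\<lambda>t. f (tangent_angle \<theta>0 k t))"
      by (rule continuous_on_eq) (rule eq)
    then show ?thesis using eq by (subst set_integral_continuous_eq_integral) (auto intro!: integral_cong)
  qed
  have \<Gamma>_b: "\<Gamma> s = bcurve z0 \<theta>0 k s" if "s \<in> {0..2 * pi}" for s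
    using trig[OF cs(1) that] trig[OF cs(2) that] by (simp add: \<Gamma>_def bcurve_def prod_eq_iff)
  have combine: "integral {0..c} f + integral {c..d} f = integral {0..d} f"
    if "f integrable_on {0..4 * pi}" "0 \<le> c" "c \<le> d" "d \<le> 4 * pi" for c d and f :: "real \<Rightarrow> real"
    using that by (intro Henstock_Kurzweil_Integration.integral_combine) (auto intro: integrable_on_subinterval)
  have shift: "integral {c..d} f = integral {0..d - c} (\<lambda>t. f (t + c))" for c d and f :: "real \<Rightarrow> real"
    using integral_shift_real_ivl[of c c d f] by simp
  have \<Gamma>_per: "\<Gamma> (2 * pi + s) = \<Gamma> s" if "s \<in> {0..2 * pi}" for s
  proof -
    have "integral {0..2 * pi + s} (\<lambda>u. f (\<Theta> u)) = integral {0..s} (\<lambda>u. f (\<Theta> u))"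
      if f: "continuous_on UNIV f" "\<And>x. f (x + 2 * pi) = f x" "integral {0..2 * pi} (\<lambda>u. f (\<Theta> u)) = 0" for f :: "real \<Rightarrow> real"
    proof -
      have "integral {2 * pi..2 * pi + s} (\<lambda>u. f (\<Theta> u)) = integral {0..s} (\<lambda>t. f (\<Theta> (2 * pi + t)))"
        by (subst shift) (simp add: add.commute)
      also have "\<dots> = integral {0..s} (\<lambda>t. f (\<Theta> t))"
        using \<open>s \<in> {0..2 * pi}\<close> \<Theta>_per f(2) by (intro integral_cong) auto
      finally show ?thesis
        using combine[OF \<Theta>_int[OF f(1)], of "2 * pi" "2 * pi + s"] f(3) \<open>s \<in> {0..2 * pi}\<close> by simp
    qed
    from this[OF cs(1)] this[OF cs(2)] show ?thesis
      using closed trig[OF cs(1), of "2 * pi"] trig[OF cs(2), of "2 * pi"] by (simp add: \<Gamma>_def)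
  qed
  have \<Gamma>_in: "\<Gamma> s \<in> closure \<Omega>" if "s \<in> {0..4 * pi}" for s
  proof -
    have *: "\<Gamma> s \<in> closure \<Omega>" if "s \<in> {0..2 * pi}" for s
      using fr \<Gamma>_b[OF that] that by (auto simp: frontier_def)
    show ?thesis
    proof (cases "s \<le> 2 * pi")
      case False
      then show ?thesis using *[of "s - 2 * pi"] \<Gamma>_per[of "s - 2 * pi"] that by simp
    qed (use * that in auto)
  qed
  obtain s0 where s0: "s0 \<in> {0..pi}" "\<Theta> (s0 + pi) = \<Theta> s0 + pi"
  proof -
    let ?g = "\<lambda>s. \<Theta> (s + pi) - \<Theta> s - pi"
    have "continuous_on {0..pi} ?g"
      by (intro continuous_intros continuous_on_compose2[OF \<Theta>_cont] continuous_on_subset[OF \<Theta>_cont]) auto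
    moreover have "?g pi = - ?g 0" using \<Theta>_per[of 0] by simp
    ultimately have "\<exists>s. 0 \<le> s \<and> s \<le> pi \<and> ?g s = 0"
      using IVT'[of ?g 0 0 pi] IVT2'[of ?g pi 0 0] by (cases "?g 0 \<le> 0") auto
    then show ?thesis using that by (auto simp: algebra_simps)
  qed
  define \<theta> where "\<theta> c t = \<Theta> (t + c)" for c t
  define \<kappa> where "\<kappa> c t = q (t + c)" for c t
  have td: "turning_density (\<kappa> c) (\<theta> c)"
    if c: "0 \<le> c" "c \<le> 3 * pi" "\<Theta> (c + pi) = \<Theta> c + pi" for c
    unfolding turning_density_def
  proof (intro conjI ballI allI)
    show "\<kappa> c \<in> borel_measurable borel" unfolding \<kappa>_def by measurable
    show "0 \<le> \<kappa> c x" for x using qnn by (simp add: \<kappa>_def)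
    show "\<kappa> c integrable_on {0..pi}"
      using has_integral_shift_real_ivl[OF integrable_integral[OF q1[of c "c + pi"]], of c] c
      by (auto simp: \<kappa>_def[abs_def])
    show "(\<lambda>x. (\<kappa> c x)\<^sup>2) integrable_on {0..pi}"
      using has_integral_shift_real_ivl[OF integrable_integral[OF q2[of c "c + pi"]], of c] c
      by (auto simp: \<kappa>_def[abs_def])
    show "\<theta> c s = \<theta> c 0 + integral {0..s} (\<kappa> c)" if "s \<in> {0..pi}" for s
      using combine[OF q1, of c "s + c"] shift[of c "s + c" q] c that
      by (simp add: \<theta>_def \<Theta>_def \<kappa>_def[abs_def])
    show "\<theta> c pi = \<theta> c 0 + pi" using c by (simp add: \<theta>_def add.commute)
  qed
  \<comment> \<open>The half curve is the arc of the boundary recentred at the midpoint of its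
    chord. The two complementary arcs have the same midpoint \<open>?m\<close>, so one translation
    places both in the closure of \<open>\<Omega>\<close>.\<close>
  have hc: "half_curve (\<theta> c) t = \<Gamma> (t + c) - (1/2) *\<^sub>R (\<Gamma> c + \<Gamma> (pi + c))"
    if c: "0 \<le> c" "c \<le> 3 * pi" and t: "t \<in> {0..pi}" for c t
  proof -
    have 1: "integral {0..t} (\<lambda>u. f (\<theta> c u)) = integral {0..t + c} (\<lambda>u. f (\<Theta> u)) - integral {0..c} (\<lambda>u. f (\<Theta> u))"
     "integral {t..pi} (\<lambda>u. f (\<theta> c u)) = integral {0..pi + c} (\<lambda>u. f (\<Theta> u)) - integral {0..t + c} (\<lambda>u. f (\<Theta> u))"
      if f: "continuous_on UNIV f" for f :: "real \<Rightarrow> real"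
      using combine[OF \<Theta>_int[OF f], of c "t + c"] combine[OF \<Theta>_int[OF f], of "t + c" "pi + c"] c t
        integral_shift_real_ivl[of c c "t + c" "\<lambda>u. f (\<Theta> u)"]
        integral_shift_real_ivl[of "t + c" c "pi + c" "\<lambda>u. f (\<Theta> u)"]
      by (simp_all add: \<theta>_def)
    show ?thesis
      by (simp add: half_curve_def 1[OF cs(1)] 1[OF cs(2)] \<Gamma>_def prod_eq_iff field_simps)
  qed
  have c2: "\<Theta> (s0 + pi + pi) = \<Theta> (s0 + pi) + pi"
    using \<Theta>_per[of s0] s0 by (simp add: algebra_simps)
  have bounds: "0 \<le> s0" "s0 \<le> 3 * pi" "0 \<le> s0 + pi" "s0 + pi \<le> 3 * pi" using s0(1) by auto
  note td1 = td[OF bounds(1,2) s0(2)] and td2 = td[OF bounds(3,4) c2]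
  have \<Gamma>2: "\<Gamma> (pi + (s0 + pi)) = \<Gamma> s0" using \<Gamma>_per[of s0] s0(1) by (simp add: algebra_simps)
  let ?m = "(1/2) *\<^sub>R (\<Gamma> s0 + \<Gamma> (s0 + pi))"
  have h1: "half_curve (\<theta> s0) t = \<Gamma> (t + s0) - ?m" if "t \<in> {0..pi}" for t
    using hc[OF bounds(1,2) that] by (simp add: add.commute)
  have h2: "half_curve (\<theta> (s0 + pi)) t = \<Gamma> (t + (s0 + pi)) - ?m" if "t \<in> {0..pi}" for t
    using hc[OF bounds(3,4) that] \<Gamma>2 by (simp add: add.commute)
  have area: "measure lebesgue (sym_body (\<theta> s0)) + measure lebesgue (sym_body (\<theta> (s0 + pi)))
      \<le> 2 * measure lebesgue (closure \<Omega>)"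
  proof (rule measure_two_halves_le)
    show "half_turn (\<theta> s0)" "half_turn (\<theta> (s0 + pi))"
      by (rule half_turn_turning_density td1 td2)+
    show "half_curve (\<theta> (s0 + pi)) 0 = - half_curve (\<theta> s0) 0"
      using h1[of 0] h2[of 0] by (simp add: prod_eq_iff field_simps)
    show "convex (closure \<Omega>)" "compact (closure \<Omega>)" using \<Omega> by (auto simp: convex_closure)
    show "?m + half_curve (\<theta> s0) t \<in> closure \<Omega>" if "t \<in> {0..pi}" for t
      using \<Gamma>_in[of "t + s0"] that s0(1) by (simp add: h1)
    show "?m + half_curve (\<theta> (s0 + pi)) t \<in> closure \<Omega>" if "t \<in> {0..pi}" for t
      using \<Gamma>_in[of "t + (s0 + pi)"] that s0(1) by (simp add: h2)
  qed
  have "measure lebesgue (closure \<Omega>) = area \<Omega>"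
    unfolding area_def using \<Omega> by (intro measure_closure negligible_convex_frontier)
  with area have area': "\<mu> * (measure lebesgue (sym_body (\<theta> s0)) + measure lebesgue (sym_body (\<theta> (s0 + pi))))
      \<le> \<mu> * (2 * area \<Omega>)"
    using assms(1) by (intro mult_left_mono) auto
  let ?E = "\<lambda>c. integral {0..pi} (\<lambda>x. (\<kappa> c x)\<^sup>2)"
  \<comment> \<open>The two arcs together cover one full period starting at \<open>s0\<close>, whose
    energy does not depend on the starting point.\<close>
  have "?E s0 + ?E (s0 + pi) = integral {0..2 * pi} (\<lambda>t. (p t)\<^sup>2)"
  proof -
    have "?E c = integral {c..pi + c} (\<lambda>t. (q t)\<^sup>2)" for c
      using shift[of c "pi + c" "\<lambda>t. (q t)\<^sup>2"] by (simp add: \<kappa>_def)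
    then have "?E s0 + ?E (s0 + pi) = integral {0..2 * pi + s0} (\<lambda>t. (q t)\<^sup>2) - integral {0..s0} (\<lambda>t. (q t)\<^sup>2)"
      using combine[OF q2, of s0 "pi + s0"] combine[OF q2, of "s0 + pi" "pi + (s0 + pi)"] s0(1)
      by (simp add: add.commute add.left_commute)
    then show ?thesis using g2(2)[of s0] g2(3)[of s0] s0(1) by simp
  qed
  then have "sym_value \<mu> (\<kappa> s0) (\<theta> s0) + sym_value \<mu> (\<kappa> (s0 + pi)) (\<theta> (s0 + pi)) \<le> 2 * J \<mu> \<Omega> (2 * pi) k"
    using area' pk2 by (simp add: sym_value_def J_def elastic_energy_def algebra_simps)
  then have "sym_value \<mu> (\<kappa> s0) (\<theta> s0) \<le> J \<mu> \<Omega> (2 * pi) k \<or>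
      sym_value \<mu> (\<kappa> (s0 + pi)) (\<theta> (s0 + pi)) \<le> J \<mu> \<Omega> (2 * pi) k" by linarith
  then show ?thesis using td1 td2 by blast
qed

theorem mainTheorem6:
  fixes \<mu> :: real
  assumes "\<mu> \<ge> 0"
  shows "\<exists>\<Omega> k \<theta>0 z0. admissible_param \<Omega> (2 * pi) k \<theta>0 z0 \<and> centrally_symmetric \<Omega> \<and>
           (\<forall>\<Omega>' k' \<theta>0' z0'. admissible_param \<Omega>' (2 * pi) k' \<theta>0' z0' \<longrightarrow>
              J \<mu> \<Omega> (2 * pi) k \<le> J \<mu> \<Omega>' (2 * pi) k')"
proof -
  obtain \<kappa> \<theta> where min: "turning_density \<kappa> \<theta>"
    "\<And>\<kappa>' \<theta>'. turning_density \<kappa>' \<theta>' \<Longrightarrow> sym_value \<mu> \<kappa> \<theta> \<le> sym_value \<mu> \<kappa>' \<theta>'"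
    using sym_value_minimizer_exists[OF assms] by blast
  obtain k where k: "admissible_param (interior (sym_body \<theta>)) (2 * pi) k (\<theta> 0) (half_curve \<theta> 0)"
    "J \<mu> (interior (sym_body \<theta>)) (2 * pi) k = sym_value \<mu> \<kappa> \<theta>"
    using symmetric_admissible[OF min(1)] by blast
  have "J \<mu> (interior (sym_body \<theta>)) (2 * pi) k \<le> J \<mu> \<Omega>' (2 * pi) k'"
    if "admissible_param \<Omega>' (2 * pi) k' \<theta>0' z0'" for \<Omega>' k' \<theta>0' z0'
    using sym_value_le_J[OF assms that] min(2) k(2) by (metis order_trans)
  then show ?thesis
    using k(1) centrally_symmetric_interior_sym_body by blast
qed

end
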